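(* For $11\leq n\leq 12$, $$\gamma^{LD}(\mathbb{F}^n)\geq \frac{2^{n+1}}{n+1+2(n-1)/(3(n-4))},$$ and for $n\geq 13$, $$\gamma^{LD}(\mathbb{F}^n)\geq \frac{2^{n+1}}{n+2+2/(n^2-5n)-4/(3n)}.$$
   Context: $\mathbb{F}^n$ is the binary Hamming space (binary words of length $n$, adjacent when they differ in exactly one coordinate). For a code $C\subseteq\mathbb{F}^n$ (nonempty set) and a word $\mathbf{u}$, $I(\mathbf{u})=C\cap N[\mathbf{u}]$, where $N[\mathbf{u}]$ is $\mathbf{u}$ together with all words at Hamming distance $1$ from $\mathbf{u}$. $C$ is locating-dominating if $I(\mathbf{u})\neq\emptyset$ for all words $\mathbf{u}$ and $I(\mathbf{u})\neq I(\mathbf{v})$ for all distinct words $\mathbf{u},\mathbf{v}\notin C$. $\gamma^{LD}(\mathbb{F}^n)$ denotes the minimum cardinality of a locating-dominating code in $\mathbb{F}^n$. *)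

theory Defs
  imports Complex_Main
begin

definition hamming_space :: "nat \<Rightarrow> bool list set" where
  "hamming_space n = {w. length w = n}"

text \<open>Only meaningful for words of equal length.\<close>

definition hamming_dist :: "bool list \<Rightarrow> bool list \<Rightarrow> nat" where
  "hamming_dist u v = card {i. i < length u \<and> u ! i \<noteq> v ! i}"

definition closed_nbhd :: "nat \<Rightarrow> bool list \<Rightarrow> bool list set" where
  "closed_nbhd n u = insert u {v \<in> hamming_space n. hamming_dist u v = 1}"

definition is_code :: "nat \<Rightarrow> bool list set \<Rightarrow> bool" where
  "is_code n C \<longleftrightarrow> C \<subseteq> hamming_space n \<and> C \<noteq> {}"

definition I_set :: "nat \<Rightarrow> bool list set \<Rightarrow> bool list \<Rightarrow> bool list set" where
  "I_set n C u = C \<inter> closed_nbhd n u"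

definition locating_dominating :: "nat \<Rightarrow> bool list set \<Rightarrow> bool" where
  "locating_dominating n C \<longleftrightarrow>
     is_code n C \<and>
     (\<forall>u \<in> hamming_space n. I_set n C u \<noteq> {}) \<and>
     (\<forall>u \<in> hamming_space n - C. \<forall>v \<in> hamming_space n - C.
        u \<noteq> v \<longrightarrow> I_set n C u \<noteq> I_set n C v)"

definition gamma_LD :: "nat \<Rightarrow> nat" where
  "gamma_LD n = (LEAST k. \<exists>C. locating_dominating n C \<and> card C = k)"

lemma locating_dominating_hamming_space:
  "locating_dominating n (hamming_space n)"
proof -
  have "replicate n False \<in> hamming_space n"
    by (simp add: hamming_space_def)
  then show ?thesis
    by (auto simp: locating_dominating_def is_code_def I_set_def closed_nbhd_def)
qed

lemma gamma_LD_attained: "\<exists>C. locating_dominating n C \<and> card C = gamma_LD n"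
  unfolding gamma_LD_def
  by (rule LeastI_ex) (use locating_dominating_hamming_space in blast)

lemma gamma_LD_le: "locating_dominating n C \<Longrightarrow> gamma_LD n \<le> card C"
  unfolding gamma_LD_def by (rule Least_le) blast

end

theory Submission
  imports Defs
begin

text \<open>
  The share of a codeword \<open>c\<close> is the sum of \<open>1 / |I(u)|\<close> over the closed neighbourhood of \<open>c\<close>;
  the shares add up to \<open>2\<^sup>n\<close>, so the bound amounts to an upper bound on the average share.  At
  most one noncodeword is covered by \<open>c\<close> alone, and two noncodewords next to \<open>c\<close> cannot both be
  covered by exactly \<open>c\<close> and \<open>c'\<close>.  Hence the \<open>loss\<close> \<open>(n + 3) / 2 - share\<close> is at least the
  required average \<open>\<theta>\<close> unless \<open>c\<close> is \<open>high\<close>: it belongs to a \<open>star\<close>, a noncodeword \<open>u\<close> all of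
  whose neighbours but \<open>u + e\<^sub>a\<close> are codewords, and \<open>C\<close> contains nothing else near \<open>c\<close>.

  As \<open>u + e\<^sub>a\<close> must be covered, some \<open>u + e\<^sub>a + e\<^sub>b\<close> is a codeword, and then the nonhigh members
  of the star compensate for the high ones, except when all members other than \<open>u + e\<^sub>b\<close> are high.
  In this tight case the missing amount is taken from the codeword \<open>u + e\<^sub>a + e\<^sub>b\<close> and, if the
  neighbours of that codeword again form a single star (with \<open>n - 2\<close> codewords), from the members
  of this second star.
\<close>

section \<open>Reciprocal sums under a lower bound on the total\<close>

lemma inverse_sum_two_le:
  fixes a b N :: real
  assumes "3 \<le> a" "3 \<le> b" "N \<le> a + b" "6 < N"
  shows "1 / a + 1 / b \<le> 1 / 3 + 1 / (N - 3)"
proof (cases "N - 3 \<le> a")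
  case True
  have "1 / a \<le> 1 / (N - 3)" using True assms by (intro divide_left_mono) auto
  moreover have "1 / b \<le> 1 / 3" using assms by (intro divide_left_mono) auto
  ultimately show ?thesis by linarith
next
  case False
  have "1 / b \<le> 1 / (N - a)" using False assms by (intro divide_left_mono mult_pos_pos) auto
  moreover have "1 / a + 1 / (N - a) = N / (a * (N - a))"
    using False assms by (simp add: field_simps)
  \<comment> \<open>By convexity the extreme pair is (3, N - 3); the inequality is (a - 3) * (N - 3
    - a) >= 0.\<close>
  moreover have "3 * (N - 3) \<le> a * (N - a)"
    using mult_nonneg_nonneg[of "a - 3" "N - 3 - a"] False assms by (simp add: algebra_simps)
  then have "N / (a * (N - a)) \<le> N / (3 * (N - 3))"
    using False assms by (intro divide_left_mono mult_pos_pos) auto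
  moreover have "N / (3 * (N - 3)) = 1 / 3 + 1 / (N - 3)"
    using assms by (simp add: field_simps)
  ultimately show ?thesis by linarith
qed

text \<open>Each term is at least 1/6, so four terms suffice for 2/3; for two terms the extreme case
  is 3 and N - 3. In the applications \<open>m j\<close> is the \<open>cov\<close> of neighbours of
  a codeword that are covered at least three times, called heavy below.\<close>

lemma sum_half_minus_inverse_ge:
  fixes m :: "'b \<Rightarrow> nat"
  assumes fin: "finite Q" and m3: "\<And>j. j \<in> Q \<Longrightarrow> 3 \<le> m j"
    and sum: "N \<le> (\<Sum>j\<in>Q. m j)" and N: "9 \<le> N" and Q2: "2 \<le> card Q"
  shows "2 / 3 - 1 / (real N - 3) \<le> (\<Sum>j\<in>Q. 1 / 2 - 1 / real (m j))"
proof -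
  have third: "1 / real (m j) \<le> 1 / 3" if "j \<in> Q" for j
    using m3[OF that] by (intro divide_left_mono) auto
  consider "card Q = 2" | "card Q = 3" | "4 \<le> card Q" using Q2 by linarith
  then show ?thesis
  proof cases
    case 1
    then obtain x y where Q: "Q = {x, y}" "x \<noteq> y" by (auto simp: card_2_iff)
    have "real N \<le> real (m x) + real (m y)" using sum Q by auto
    then have "1 / real (m x) + 1 / real (m y) \<le> 1 / 3 + 1 / (real N - 3)"
      using m3[of x] m3[of y] Q N by (intro inverse_sum_two_le) auto
    then show ?thesis using Q by simp
  next
    case 2
    then obtain x y z where Q: "Q = {x, y, z}" "x \<noteq> y" "x \<noteq> z" "y \<noteq> z"
      by (auto simp: card_3_iff)
    have sum3: "N \<le> m x + m y + m z" using sum Q by auto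
    have t: "1 / real (m x) \<le> 1 / 3" "1 / real (m y) \<le> 1 / 3" "1 / real (m z) \<le> 1 / 3"
      using third Q by blast+
    have N3: "0 \<le> 1 / (real N - 3)" using N by simp
    have *: "1 / real (m x) + 1 / real (m y) + 1 / real (m z) \<le> 5 / 6 + 1 / (real N - 3)"
    proof -
      have drop: "1 / real k \<le> 1 / real l" if "0 < l" "l \<le> k" for k l :: nat
        using that by (intro divide_left_mono) auto
      \<comment> \<open>Three terms 1/3 exceed 5/6 by 1/6. A value 6 recovers this; without one, N
        <= 15, so 1/(N - 3) supplies 1/12 and a value 4 the other 1/12; if all values are 3, then N
        = 9 and 1/(N - 3) = 1/6.\<close>
      consider "6 \<le> m x \<or> 6 \<le> m y \<or> 6 \<le> m z"
        | "N \<le> 15" "4 \<le> m x \<or> 4 \<le> m y \<or> 4 \<le> m z"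
        | "N = 9"
        using sum3 N by linarith
      then show ?thesis
      proof cases
        case 1
        then have "1 / real (m x) \<le> 1 / 6 \<or> 1 / real (m y) \<le> 1 / 6 \<or> 1 / real (m z) \<le> 1 / 6"
          using drop[of 6] by (metis of_nat_numeral zero_less_numeral)
        then show ?thesis using t N3 by linarith
      next
        case 2
        then have "1 / real (m x) \<le> 1 / 4 \<or> 1 / real (m y) \<le> 1 / 4 \<or> 1 / real (m z) \<le> 1 / 4"
          using drop[of 4] by (metis of_nat_numeral zero_less_numeral)
        moreover have "1 / 12 \<le> 1 / (real N - 3)" using 2 N by (intro divide_left_mono) auto
        ultimately show ?thesis using t by linarith
      next
        case 3
        then have "1 / (real N - 3) = 1 / 6" by simp
        then show ?thesis using t by linarith
      qed
    qed
    have "(\<Sum>j\<in>Q. 1 / 2 - 1 / real (m j))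
      = 3 / 2 - (1 / real (m x) + 1 / real (m y) + 1 / real (m z))"
      using Q by simp
    then show ?thesis using * by linarith
  next
    case 3
    have "1 / 6 \<le> 1 / 2 - 1 / real (m j)" if "j \<in> Q" for j using third[OF that] by linarith
    then have "real (card Q) * (1 / 6) \<le> (\<Sum>j\<in>Q. 1 / 2 - 1 / real (m j))"
      by (intro sum_bounded_below) auto
    moreover have "0 \<le> 1 / (real N - 3)" using N by simp
    ultimately show ?thesis using 3 by linarith
  qed
qed

section \<open>Shares in an abstract cube\<close>

text \<open>Only commuting involutions \<open>flip i\<close> are needed.  Codewords around a word are counted by
  directions, which avoids all distinctness arguments between words.\<close>

locale ld_cube =
  fixes n :: nat and W :: "'a set" and flip :: "nat \<Rightarrow> 'a \<Rightarrow> 'a" and C :: "'a set"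
  assumes finite_W: "finite W"
    and flip_in_W: "v \<in> W \<Longrightarrow> flip i v \<in> W"
    and flip_flip [simp]: "flip i (flip i v) = v"
    and flip_commute: "flip i (flip j v) = flip j (flip i v)"
    and C_subset: "C \<subseteq> W"
    and dominated: "v \<in> W \<Longrightarrow> v \<notin> C \<Longrightarrow> \<exists>i<n. flip i v \<in> C"
    and private_unique: "\<lbrakk>c \<in> C; i < n; j < n; i \<noteq> j; flip i c \<notin> C; flip j c \<notin> C;
      {k. k < n \<and> flip k (flip i c) \<in> C} = {i}\<rbrakk> \<Longrightarrow> {k. k < n \<and> flip k (flip j c) \<in> C} \<noteq> {j}"
    and pair_unique: "\<lbrakk>c \<in> C; i < n; j < n; i \<noteq> j; flip i c \<notin> C; flip j c \<notin> C;
      {k. k < n \<and> flip k (flip i c) \<in> C} = {i, j}\<rbrakk> \<Longrightarrow> {k. k < n \<and> flip k (flip j c) \<in> C} \<noteq> {i, j}"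
begin

definition dirs :: "'a \<Rightarrow> nat set" where
  "dirs v = {k. k < n \<and> flip k v \<in> C}"

text \<open>This is |I(v)|; the additional 1 counts a codeword as covering itself.\<close>

definition cov :: "'a \<Rightarrow> nat" where
  "cov v = card (dirs v) + (if v \<in> C then 1 else 0)"

text \<open>In the \<open>loss\<close> below, the neighbour of \<open>c\<close> covered by \<open>c\<close> alone, if there is one, has
  \<open>gain\<close> \<open>- 1 / 2\<close>; all other neighbours have nonnegative gain.\<close>

definition gain :: "'a \<Rightarrow> nat \<Rightarrow> real" where
  "gain c i = 1 / 2 - 1 / real (cov (flip i c))"

text \<open>The amount (n + 3) / 2 is split into 3/2 for \<open>c\<close> and 1/2 for each
  direction.\<close>

definition loss :: "'a \<Rightarrow> real" where
  "loss c = 3 / 2 - 1 / real (cov c) + (\<Sum>i<n. gain c i)"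

lemma dirs_iff: "k \<in> dirs v \<longleftrightarrow> k < n \<and> flip k v \<in> C"
  by (simp add: dirs_def)

lemma dirs_singleton:
  assumes "\<And>k. k < n \<Longrightarrow> flip k v \<in> C \<Longrightarrow> k = b" "b < n" "flip b v \<in> C"
  shows "dirs v = {b}"
proof -
  have "k = b" if "k \<in> dirs v" for k using assms(1)[of k] that by (simp add: dirs_iff)
  moreover have "b \<in> dirs v" using assms(2,3) by (simp add: dirs_iff)
  ultimately show ?thesis by blast
qed

lemma finite_dirs [simp]: "finite (dirs v)"
  by (simp add: dirs_def)

lemma finite_C: "finite C"
  using C_subset finite_W finite_subset by blast

lemma code_in_W: "c \<in> C \<Longrightarrow> c \<in> W"
  using C_subset by blast

lemma cov_pos: "v \<in> W \<Longrightarrow> 1 \<le> cov v"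
proof (cases "v \<in> C")
  case False
  assume "v \<in> W"
  then have "dirs v \<noteq> {}" using dominated[of v] False by (auto simp: dirs_def)
  then show ?thesis by (simp add: cov_def Suc_le_eq card_gt_0_iff)
qed (simp add: cov_def)

lemma cov_ge_card: "S \<subseteq> dirs v \<Longrightarrow> card S \<le> cov v"
  by (simp add: cov_def card_mono trans_le_add1)

lemma cov_code_ge_card: "v \<in> C \<Longrightarrow> S \<subseteq> dirs v \<Longrightarrow> Suc (card S) \<le> cov v"
  by (simp add: cov_def card_mono)

lemma cov_noncode: "v \<notin> C \<Longrightarrow> cov v = card (dirs v)"
  by (simp add: cov_def)

lemma cov_ge2_gain: "2 \<le> cov (flip i c) \<Longrightarrow> 0 \<le> gain c i"
  by (simp add: gain_def divide_simps)

lemma cov_ge3_gain: "3 \<le> cov (flip i c) \<Longrightarrow> 1 / 6 \<le> gain c i"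
  by (simp add: gain_def divide_simps)

lemma self_dir: "c \<in> C \<Longrightarrow> i < n \<Longrightarrow> i \<in> dirs (flip i c)"
  by (simp add: dirs_iff)

section \<open>Private neighbours and lower bounds for the loss\<close>

lemma private_noncode:
  assumes "c \<in> C" "i < n" "cov (flip i c) = 1"
  shows "flip i c \<notin> C" "dirs (flip i c) = {i}"
proof -
  have "{i} \<subseteq> dirs (flip i c)" using self_dir assms by simp
  then show nc: "flip i c \<notin> C" using cov_code_ge_card[of "flip i c" "{i}"] assms by auto
  have "card (dirs (flip i c)) = 1" using assms nc by (simp add: cov_noncode)
  then show "dirs (flip i c) = {i}" using self_dir[of c i] assms by (auto simp: card_1_singleton_iff)
qed

text \<open>Two neighbours covered by \<open>c\<close> alone would be noncodewords with the same
  I-set {c}.\<close>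

lemma card_private_le:
  assumes c: "c \<in> C"
  shows "card {i. i < n \<and> cov (flip i c) = 1} \<le> 1"
proof -
  have "i = j" if "i < n" "cov (flip i c) = 1" "j < n" "cov (flip j c) = 1" for i j
    using private_noncode[OF c that(1,2)] private_noncode[OF c that(3,4)]
      private_unique[OF c that(1,3)] by (auto simp: dirs_def[symmetric])
  then show ?thesis by (simp add: card_le_Suc0_iff_eq)
qed

lemma private_eq:
  assumes c: "c \<in> C" and "i < n" "cov (flip i c) = 1" "j < n" "cov (flip j c) = 1"
  shows "i = j"
  using card_private_le[OF c] assms by (auto simp: card_le_Suc0_iff_eq)

lemma loss_ge_aux:
  assumes c: "c \<in> C" and A: "A \<subseteq> {..<n}" "\<And>i. i \<in> A \<Longrightarrow> 2 \<le> cov (flip i c)"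
  shows "3 / 2 - real (card {i. i < n \<and> cov (flip i c) = 1}) / 2 - 1 / real (cov c)
    + (\<Sum>i\<in>A. gain c i) \<le> loss c"
proof -
  let ?P = "{i. i < n \<and> cov (flip i c) = 1}"
  have cov2: "2 \<le> cov (flip i c)" if "i \<in> {..<n} - ?P" for i
    using cov_pos[of "flip i c"] that c code_in_W flip_in_W by force
  have "(\<Sum>i<n. gain c i) = (\<Sum>i\<in>{..<n} - ?P. gain c i) + (\<Sum>i\<in>?P. gain c i)"
    by (intro sum.subset_diff) auto
  moreover have "(\<Sum>i\<in>?P. gain c i) = (\<Sum>i\<in>?P. - (1 / 2))"
    by (intro sum.cong) (auto simp: gain_def)
  moreover have "(\<Sum>i\<in>A. gain c i) \<le> (\<Sum>i\<in>{..<n} - ?P. gain c i)"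
  proof (intro sum_mono2)
    show "A \<subseteq> {..<n} - ?P" using A by force
  qed (use cov2 cov_ge2_gain in auto)
  ultimately show ?thesis by (simp add: loss_def)
qed

lemma loss_ge:
  assumes c: "c \<in> C" and "A \<subseteq> {..<n}" "\<And>i. i \<in> A \<Longrightarrow> 2 \<le> cov (flip i c)"
  shows "1 - 1 / real (cov c) + (\<Sum>i\<in>A. gain c i) \<le> loss c"
  using loss_ge_aux[OF assms] card_private_le[OF c] by linarith

lemma loss_ge_no_private:
  assumes c: "c \<in> C" and "A \<subseteq> {..<n}" "\<And>i. i \<in> A \<Longrightarrow> 2 \<le> cov (flip i c)"
    and "\<And>i. i < n \<Longrightarrow> cov (flip i c) \<noteq> 1"
  shows "3 / 2 - 1 / real (cov c) + (\<Sum>i\<in>A. gain c i) \<le> loss c"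
proof -
  have "{i. i < n \<and> cov (flip i c) = 1} = {}" using assms by auto
  then show ?thesis using loss_ge_aux[OF assms(1-3)] by (simp only: card.empty) simp
qed

lemma self_loss_nonneg: "c \<in> C \<Longrightarrow> 0 \<le> 1 - 1 / real (cov c)"
  using cov_pos[of c] code_in_W[of c] by (auto simp: divide_simps)

lemma self_loss_ge: "1 \<le> card (dirs c) \<Longrightarrow> c \<in> C \<Longrightarrow> 1 / 2 \<le> 1 - 1 / real (cov c)"
  by (auto simp: divide_simps cov_def)

text \<open>The two common neighbours of \<open>c\<close> and \<open>c + e\<^sub>i + e\<^sub>j\<close> cannot both have exactly these two as
  their \<open>I\<close>-set.\<close>

lemma leaf_partner:
  assumes c: "c \<in> C" "i < n" "flip i c \<notin> C" "cov (flip i c) = 2"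
  obtains j where "j < n" "j \<noteq> i" "3 \<le> cov (flip j c)" "i \<in> dirs (flip j c)" "j \<in> dirs (flip i c)"
proof -
  have "card (dirs (flip i c)) = 2" using c by (simp add: cov_noncode)
  moreover have i: "i \<in> dirs (flip i c)" using self_dir c by simp
  ultimately obtain j where j: "dirs (flip i c) = {i, j}" "i \<noteq> j"
    unfolding card_2_iff by (metis empty_iff insert_commute insert_iff)
  have jn: "j < n" "flip j (flip i c) \<in> C" using j by (auto simp: dirs_def)
  then have ij: "i \<in> dirs (flip j c)" using c by (simp add: dirs_iff flip_commute)
  have sub: "{i, j} \<subseteq> dirs (flip j c)" using ij self_dir c jn by simp
  have "3 \<le> cov (flip j c)"
  proof (cases "flip j c \<in> C")
    case True
    then show ?thesis using cov_code_ge_card[OF True sub] j by simp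
  next
    case False
    have "dirs (flip j c) \<noteq> {i, j}"
      using pair_unique[OF c(1,2) jn(1) j(2) c(3) False] j(1) by (simp add: dirs_def)
    then have "card {i, j} < card (dirs (flip j c))"
      using sub by (intro psubset_card_mono) auto
    then show ?thesis using j False by (simp add: cov_noncode)
  qed
  then show ?thesis using that[of j] jn j ij by auto
qed

text \<open>Each \<open>i\<close> in \<open>K\<close> lies in \<open>dirs (flip j c)\<close> for
  some \<open>j\<close> in \<open>Q\<close>: either \<open>j = i\<close>, or \<open>j\<close> is the
  partner given by \<open>leaf_partner\<close>. Thus the heavy neighbours account for all of
  \<open>K\<close>.\<close>

lemma card_le_sum_cov:
  assumes c: "c \<in> C" and K: "K \<subseteq> {..<n}"
    and KP: "\<And>i. i \<in> K \<Longrightarrow> flip i c \<notin> C" "\<And>i. i \<in> K \<Longrightarrow> 2 \<le> cov (flip i c)"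
    and Q: "Q = {i. i < n \<and> 3 \<le> cov (flip i c)}"
  shows "card K \<le> (\<Sum>j\<in>Q. cov (flip j c))"
proof -
  have "K \<subseteq> (\<Union>j\<in>Q. dirs (flip j c))"
  proof
    fix i assume i: "i \<in> K"
    then have "i < n" using K by auto
    consider "3 \<le> cov (flip i c)" | "cov (flip i c) = 2" using KP(2)[OF i] by linarith
    then show "i \<in> (\<Union>j\<in>Q. dirs (flip j c))"
    proof cases
      case 1
      then show ?thesis using \<open>i < n\<close> self_dir[OF c, of i] Q by auto
    next
      case 2
      then obtain j where "j < n" "3 \<le> cov (flip j c)" "i \<in> dirs (flip j c)"
        using leaf_partner[OF c \<open>i < n\<close> KP(1)[OF i]] by metis
      then show ?thesis using Q by auto
    qed
  qed
  moreover have finQ: "finite Q" using Q by simp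
  ultimately have "card K \<le> card (\<Union>j\<in>Q. dirs (flip j c))" by (intro card_mono) auto
  also have "\<dots> \<le> (\<Sum>j\<in>Q. card (dirs (flip j c)))" using finQ by (rule card_UN_le)
  also have "\<dots> \<le> (\<Sum>j\<in>Q. cov (flip j c))" by (intro sum_mono) (simp add: cov_def)
  finally show ?thesis .
qed

section \<open>Double counting of shares\<close>

lemma sum_share:
  "(\<Sum>c\<in>C. 1 / real (cov c) + (\<Sum>i<n. 1 / real (cov (flip i c)))) = real (card W)"
proof -
  let ?f = "\<lambda>v. 1 / real (cov v)"
  \<comment> \<open>Each word hands 1/|I(v)| to every member of I(v), in total 1.\<close>
  have one: "(if v \<in> C then ?f v else 0) + (\<Sum>i<n. if flip i v \<in> C then ?f v else 0) = 1"
    if "v \<in> W" for v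
  proof -
    have "(\<Sum>i<n. if flip i v \<in> C then ?f v else 0) = (\<Sum>i\<in>dirs v. ?f v)"
      by (rule sum.mono_neutral_cong_right) (auto simp: dirs_def)
    then have "(if v \<in> C then ?f v else 0) + (\<Sum>i<n. if flip i v \<in> C then ?f v else 0)
      = real (cov v) * ?f v"
      by (auto simp: cov_def field_simps)
    then show ?thesis using cov_pos[OF that] by simp
  qed
  have shift: "(\<Sum>v\<in>W. if flip i v \<in> C then ?f v else 0) = (\<Sum>c\<in>C. ?f (flip i c))" for i
  proof -
    have "(\<Sum>c\<in>C. ?f (flip i c)) = (\<Sum>v\<in>{v \<in> W. flip i v \<in> C}. ?f v)"
      by (rule sum.reindex_bij_witness[of _ "flip i" "flip i"])
        (auto simp: flip_in_W code_in_W)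
    also have "\<dots> = (\<Sum>v\<in>W. if flip i v \<in> C then ?f v else 0)"
      using finite_W by (intro sum.mono_neutral_cong_left) auto
    finally show ?thesis by simp
  qed
  have "real (card W) = (\<Sum>v\<in>W. (if v \<in> C then ?f v else 0)
      + (\<Sum>i<n. if flip i v \<in> C then ?f v else 0))"
    using one by simp
  also have "\<dots> = (\<Sum>v\<in>W. if v \<in> C then ?f v else 0)
      + (\<Sum>i<n. \<Sum>v\<in>W. if flip i v \<in> C then ?f v else 0)"
    by (simp add: sum.distrib sum.swap[of _ W])
  also have "(\<Sum>v\<in>W. if v \<in> C then ?f v else 0) = (\<Sum>c\<in>C. ?f c)"
    using finite_W C_subset by (intro sum.mono_neutral_cong_right) auto
  finally show ?thesis by (simp add: shift sum.distrib sum.swap[of _ C])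
qed

lemma sum_loss: "(\<Sum>c\<in>C. loss c) = real (card C) * (real n + 3) / 2 - real (card W)"
proof -
  have "loss c = (real n + 3) / 2 - (1 / real (cov c) + (\<Sum>i<n. 1 / real (cov (flip i c))))" for c
    by (simp add: loss_def gain_def sum_subtractf add_divide_distrib)
  then show ?thesis by (simp add: sum_subtractf sum_share)
qed

end

section \<open>Stars\<close>

text \<open>\<theta> is the average loss aimed at. \<open>\<theta>_le\<close> serves codewords with
  two heavy neighbours, \<open>\<theta>_star\<close> the balance of a star that is not tight,
  \<open>\<theta>_tight\<close> and \<open>\<theta>_tight_star\<close> that of a tight star without
  and with a second star, and \<open>\<theta>_second_star\<close> leaves 1/60 at each member of a
  second star.\<close>

locale ld_cube_threshold = ld_cube +
  fixes \<theta> :: real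
  assumes n_ge: "11 \<le> n"
    and \<theta>_le: "\<theta> \<le> 2 / 3 - 1 / (real n - 4)"
    and \<theta>_star: "(real n - 1) * (\<theta> - (1 / 2 - 1 / (real n - 1))) \<le> 5 / 3"
    and \<theta>_tight: "real n * \<theta> + 1 / (real n - 5) \<le> real n / 2 + 2 / 3"
    and \<theta>_tight_star: "real n * \<theta> + 1 / (real n - 2) \<le> real n / 2 + 1 / 2 + (real n - 3) / 60"
    and \<theta>_second_star: "\<theta> + 1 / (real n - 2) + 1 / 60 \<le> 2 / 3"
begin

text \<open>Here 3/2 - 1 cancels the private -1/2 and doubly covered neighbours gain 0, so the loss
  is exactly 1/2 - 1/(n - 1), the gain of the star centre \<open>flip j c\<close>.\<close>

definition high :: "nat \<Rightarrow> nat \<Rightarrow> 'a \<Rightarrow> bool" where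
  "high a j c \<longleftrightarrow> c \<in> C \<and> a < n \<and> j < n \<and> a \<noteq> j \<and> cov c = 1 \<and> cov (flip a c) = 1 \<and>
     cov (flip j c) = n - 1 \<and> (\<forall>i<n. i \<noteq> a \<longrightarrow> i \<noteq> j \<longrightarrow> cov (flip i c) = 2)"

definition star :: "nat \<Rightarrow> 'a \<Rightarrow> bool" where
  "star a u \<longleftrightarrow> u \<in> W \<and> u \<notin> C \<and> a < n \<and> dirs u = {..<n} - {a}"

lemma \<theta>_le_two_thirds: "\<theta> \<le> 2 / 3"
proof -
  have "0 \<le> 1 / (real n - 4)" using n_ge by simp
  then show ?thesis using \<theta>_le by linarith
qed

lemma cov1_dirs: "c \<in> C \<Longrightarrow> cov c = 1 \<Longrightarrow> dirs c = {}"
  by (simp add: cov_def)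

text \<open>Two code neighbours give 1 - 1/3; one gives 1/2, and a heavy neighbour adds 1/6. An
  isolated \<open>c\<close> without private neighbour also reaches 1/2 + 1/6. With one, two heavy
  neighbours reach \<theta>, while a single one must account for all remaining directions, which is
  the high case.\<close>

lemma loss_ge_or_high:
  assumes c: "c \<in> C"
  shows "\<theta> \<le> loss c \<or> (\<exists>a j. high a j c)"
proof -
  define Q where "Q = {i. i < n \<and> 3 \<le> cov (flip i c)}"
  define P where "P = {i. i < n \<and> cov (flip i c) = 1}"
  have finQ: "finite Q" by (simp add: Q_def)
  have P1: "card P \<le> 1" unfolding P_def by (rule card_private_le[OF c])
  have lossQ: "1 - 1 / real (cov c) + (\<Sum>i\<in>Q. gain c i) \<le> loss c"
    by (rule loss_ge[OF c]) (auto simp: Q_def)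
  have Q6: "1 / 6 * real (card Q) \<le> (\<Sum>i\<in>Q. gain c i)"
    using sum_bounded_below[of Q "1 / 6" "gain c"] cov_ge3_gain by (auto simp: Q_def)
  define K where "K = {..<n} - P - dirs c"
  have K2: "2 \<le> cov (flip i c)" if "i \<in> K" for i
    using that cov_pos[of "flip i c"] c code_in_W flip_in_W by (force simp: K_def P_def)
  have KC: "flip i c \<notin> C" if "i \<in> K" for i using that by (auto simp: K_def dirs_iff)
  have "card K \<le> (\<Sum>j\<in>Q. cov (flip j c))"
    by (rule card_le_sum_cov[OF c _ KC K2 Q_def]) (auto simp: K_def)
  moreover have "n \<le> card K + card P + card (dirs c)"
  proof -
    have "{..<n} \<subseteq> K \<union> P \<union> dirs c" by (auto simp: K_def)
    then have "card {..<n} \<le> card (K \<union> P \<union> dirs c)"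
      by (intro card_mono) (auto simp: K_def P_def)
    also have "\<dots> \<le> card K + card P + card (dirs c)"
      by (metis add_le_mono1 card_Un_le le_trans)
    finally show ?thesis by simp
  qed
  ultimately have nQ: "n \<le> (\<Sum>j\<in>Q. cov (flip j c)) + card P + card (dirs c)" by linarith
  have Qne: "1 \<le> card Q" if "card (dirs c) \<le> 1"
  proof (rule ccontr)
    assume "\<not> 1 \<le> card Q"
    then have "card Q = 0" by linarith
    then have "Q = {}" using finQ by simp
    then show False using nQ P1 that n_ge by simp
  qed
  have covc: "cov c = Suc (card (dirs c))" using c by (simp add: cov_def)
  consider "2 \<le> card (dirs c)" | "card (dirs c) = 1" | "card (dirs c) = 0" by linarith
  then show ?thesis
  proof cases
    case 1
    then have "1 / real (cov c) \<le> 1 / 3" using covc by (intro divide_left_mono) auto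
    moreover have "0 \<le> 1 / 6 * real (card Q)" by simp
    ultimately show ?thesis using lossQ Q6 \<theta>_le_two_thirds by linarith
  next
    case 2
    then have "1 / real (cov c) = 1 / 2" using covc by simp
    then show ?thesis using lossQ Q6 Qne 2 \<theta>_le_two_thirds by force
  next
    case 3
    then have cov1: "cov c = 1" using covc by simp
    have dirs0: "dirs c = {}" using 3 by simp
    show ?thesis
    proof (cases "P = {}")
      case True
      have "3 / 2 - 1 / real (cov c) + (\<Sum>i\<in>Q. gain c i) \<le> loss c"
        using True by (intro loss_ge_no_private[OF c]) (auto simp: Q_def P_def)
      then show ?thesis using cov1 Q6 Qne 3 \<theta>_le_two_thirds by force
    next
      case False
      then obtain a where a: "a < n" "cov (flip a c) = 1" by (auto simp: P_def)
      have nQ': "n - 1 \<le> (\<Sum>j\<in>Q. cov (flip j c))" using nQ P1 3 by linarith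
      show ?thesis
      proof (cases "card Q = 1")
        case True
        then obtain j where j: "Q = {j}" by (auto simp: card_1_singleton_iff)
        then have jn: "j < n" "3 \<le> cov (flip j c)" by (auto simp: Q_def)
        have aj: "a \<noteq> j" using a jn by auto
        \<comment> \<open>Otherwise \<open>flip a (flip j c)\<close> would be a second cover of the
          private neighbour \<open>flip a c\<close>.\<close>
        have notin: "a \<notin> dirs (flip j c)"
        proof
          assume "a \<in> dirs (flip j c)"
          then have "j \<in> dirs (flip a c)" using jn by (simp add: dirs_iff flip_commute)
          then show False using private_noncode[OF c a] aj by simp
        qed
        then have "dirs (flip j c) \<subseteq> {..<n} - {a}" by (auto simp: dirs_iff)
        then have "card (dirs (flip j c)) \<le> n - 1" using a card_mono[of "{..<n} - {a}"] by simp
        moreover have "flip j c \<notin> C" using dirs0 jn by (auto simp: dirs_def)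
        ultimately have "cov (flip j c) = n - 1" using nQ' j by (simp add: cov_noncode)
        moreover have "cov (flip i c) = 2" if "i < n" "i \<noteq> a" "i \<noteq> j" for i
        proof -
          have "i \<notin> Q" using j that by simp
          then have "cov (flip i c) \<le> 2" using that by (auto simp: Q_def)
          moreover have "cov (flip i c) \<noteq> 1" using private_eq[OF c] a that by blast
          moreover have "1 \<le> cov (flip i c)" using cov_pos flip_in_W code_in_W c by blast
          ultimately show ?thesis by linarith
        qed
        ultimately have "high a j c" using c a jn aj cov1 by (auto simp: high_def)
        then show ?thesis by blast
      next
        case False
        then have "2 \<le> card Q" using Qne 3 by linarith
        \<comment> \<open>One direction is private, so N = n - 1; this is the source of 1/(n - 4) in
          \<open>\<theta>_le\<close>.\<close>
        then have "2 / 3 - 1 / (real (n - 1) - 3) \<le> (\<Sum>j\<in>Q. 1 / 2 - 1 / real (cov (flip j c)))"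
          using nQ' n_ge by (intro sum_half_minus_inverse_ge[OF finQ]) (auto simp: Q_def)
        moreover have "real (n - 1) - 3 = real n - 4" using n_ge by simp
        ultimately show ?thesis using lossQ cov1 \<theta>_le by (simp add: gain_def)
      qed
    qed
  qed
qed

lemma high_star:
  assumes h: "high a j c"
  shows "star a (flip j c)"
proof -
  from h have c: "c \<in> C" "a < n" "j < n" "a \<noteq> j" "cov c = 1" "cov (flip a c) = 1"
    "cov (flip j c) = n - 1" by (auto simp: high_def)
  have nc: "flip j c \<notin> C" using cov1_dirs c by (auto simp: dirs_def)
  have "a \<notin> dirs (flip j c)"
  proof
    assume "a \<in> dirs (flip j c)"
    then have "j \<in> dirs (flip a c)" using c by (simp add: dirs_iff flip_commute)
    then show False using private_noncode[OF c(1,2,6)] c by simp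
  qed
  then have "dirs (flip j c) \<subseteq> {..<n} - {a}" by (auto simp: dirs_iff)
  moreover have "card (dirs (flip j c)) = card ({..<n} - {a})" using c nc by (simp add: cov_noncode)
  ultimately have "dirs (flip j c) = {..<n} - {a}" by (intro card_subset_eq) auto
  then show ?thesis using c nc code_in_W flip_in_W by (auto simp: star_def)
qed

abbreviation star_gain :: real where
  "star_gain \<equiv> 1 / 2 - 1 / (real n - 1)"

lemma starD:
  assumes "star a u"
  shows "u \<in> W" "u \<notin> C" "a < n" "dirs u = {..<n} - {a}" "cov u = n - 1" "flip a u \<notin> C"
    "\<And>j. j < n \<Longrightarrow> j \<noteq> a \<Longrightarrow> flip j u \<in> C"
    "\<And>j. gain (flip j u) j = star_gain"
proof -
  show s: "u \<in> W" "u \<notin> C" "a < n" "dirs u = {..<n} - {a}" using assms by (auto simp: star_def)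
  show cu: "cov u = n - 1" using s by (simp add: cov_noncode)
  show "flip a u \<notin> C" using s by (auto simp: dirs_def)
  show "flip j u \<in> C" if "j < n" "j \<noteq> a" for j
  proof -
    have "j \<in> dirs u" using that s by simp
    then show ?thesis by (simp add: dirs_iff)
  qed
  show "gain (flip j u) j = star_gain" for j using cu n_ge by (simp add: gain_def of_nat_diff)
qed

section \<open>Losses of the members of a star\<close>

context
  fixes a u assumes st: "star a u"
begin

lemma star_pair_dirs:
  assumes "j < n" "j \<noteq> a" "k < n" "k \<noteq> a"
  shows "{j, k} \<subseteq> dirs (flip k (flip j u))"
proof -
  have "flip k u \<in> C" "flip j u \<in> C" using starD(7)[OF st] assms by auto
  then show ?thesis using assms flip_commute[of j k "flip j u"] flip_commute[of j k u]
    by (auto simp: dirs_iff)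
qed

lemma star_pair_cov:
  assumes "j < n" "j \<noteq> a" "k < n" "k \<noteq> a" "j \<noteq> k"
  shows "2 \<le> cov (flip k (flip j u))"
  using cov_ge_card[OF star_pair_dirs[OF assms(1-4)]] assms by simp

lemma star_cov: "2 \<le> cov u"
  using starD(5)[OF st] n_ge by simp

lemma star_loss_ge:
  assumes j: "j < n" "j \<noteq> a"
  shows "star_gain \<le> loss (flip j u)"
proof -
  note c = starD(7)[OF st j]
  have "1 - 1 / real (cov (flip j u)) + (\<Sum>i\<in>{j}. gain (flip j u) i) \<le> loss (flip j u)"
    using j star_cov by (intro loss_ge[OF c]) auto
  then show ?thesis using self_loss_nonneg[OF c] starD(8)[OF st, of j] by simp
qed

text \<open>Only direction \<open>a\<close> can be private for a member, since any other
  \<open>flip k (flip j u)\<close> is also covered by \<open>flip k u\<close>. Here it leads to a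
  codeword: 1/2 is saved for the absent private neighbour and 1/2 for the second cover of
  \<open>flip j u\<close>.\<close>

lemma star_loss_code:
  assumes j: "j < n" "j \<noteq> a" and aj: "flip a (flip j u) \<in> C"
  shows "star_gain + 1 \<le> loss (flip j u)"
proof -
  note c = starD(7)[OF st j]
  have "a \<in> dirs (flip j u)" using aj starD(3)[OF st] by (simp add: dirs_iff)
  then have "1 \<le> card (dirs (flip j u))" by (simp add: Suc_le_eq card_gt_0_iff) blast
  moreover have "cov (flip i (flip j u)) \<noteq> 1" if "i < n" for i
  proof -
    consider "i = a" | "i = j" | "i \<noteq> a" "i \<noteq> j" by blast
    then show ?thesis
    proof cases
      case 1
      then show ?thesis using private_noncode(1)[OF c that] aj by blast
    next
      case 2
      then show ?thesis using star_cov by simp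
    next
      case 3
      then show ?thesis using star_pair_cov[OF j that] by simp
    qed
  qed
  then have "3 / 2 - 1 / real (cov (flip j u)) + (\<Sum>i\<in>{j}. gain (flip j u) i) \<le> loss (flip j u)"
    using j star_cov by (intro loss_ge_no_private[OF c]) auto
  ultimately show ?thesis using self_loss_ge[OF _ c] starD(8)[OF st, of j] by simp
qed

text \<open>The absent private neighbour saves 1/2. A further codeword
  \<open>flip k (flip a (flip j u))\<close> is a third cover of \<open>flip k (flip j u)\<close>,
  which adds 1/6.\<close>

lemma star_loss_not_private:
  assumes j: "j < n" "j \<noteq> a" and aj: "flip a (flip j u) \<notin> C" "cov (flip a (flip j u)) \<noteq> 1"
  shows "star_gain + 2 / 3 \<le> loss (flip j u)"
proof -
  note c = starD(7)[OF st j]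
  have an: "a < n" using starD(3)[OF st] .
  have "dirs (flip a (flip j u)) \<noteq> {a}" using aj by (auto simp: cov_noncode)
  moreover have "a \<in> dirs (flip a (flip j u))" using self_dir[OF c an] .
  ultimately obtain k where k: "k \<in> dirs (flip a (flip j u))" "k \<noteq> a" by blast
  have "k \<noteq> j"
  proof
    assume "k = j"
    then have "flip a u \<in> C" using k flip_commute[of j a "flip j u"] by (simp add: dirs_iff)
    then show False using starD(6)[OF st] by blast
  qed
  have kn: "k < n" using k by (simp add: dirs_iff)
  have "{j, k, a} \<subseteq> dirs (flip k (flip j u))"
    using star_pair_dirs[OF j kn k(2)] k an by (auto simp: dirs_iff flip_commute)
  then have k3: "3 \<le> cov (flip k (flip j u))"
    using cov_ge_card[of "{j, k, a}" "flip k (flip j u)"] k(2) \<open>k \<noteq> j\<close> j by auto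
  have "cov (flip i (flip j u)) \<noteq> 1" if "i < n" for i
  proof -
    consider "i = a" | "i = j" | "i \<noteq> a" "i \<noteq> j" by blast
    then show ?thesis
    proof cases
      case 1
      then show ?thesis using aj by blast
    next
      case 2
      then show ?thesis using star_cov by simp
    next
      case 3
      then show ?thesis using star_pair_cov[OF j that] by simp
    qed
  qed
  then have "3 / 2 - 1 / real (cov (flip j u)) + (\<Sum>i\<in>{j, k}. gain (flip j u) i) \<le> loss (flip j u)"
    using j kn star_cov k3 by (intro loss_ge_no_private[OF c]) auto
  then show ?thesis using self_loss_nonneg[OF c] starD(8)[OF st, of j] \<open>k \<noteq> j\<close> cov_ge3_gain[OF k3]
    by simp
qed

text \<open>The codeword \<open>flip k (flip j u)\<close> is a second cover of
  \<open>flip j u\<close>, worth 1/2, and a third cover of itself, worth 1/6.\<close>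

lemma star_loss_pair:
  assumes j: "j < n" "j \<noteq> a" and k: "k < n" "k \<noteq> a" "j \<noteq> k" and jk: "flip k (flip j u) \<in> C"
  shows "star_gain + 2 / 3 \<le> loss (flip j u)"
proof -
  note c = starD(7)[OF st j]
  have "k \<in> dirs (flip j u)" using jk k by (simp add: dirs_iff)
  then have "1 \<le> card (dirs (flip j u))" by (simp add: Suc_le_eq card_gt_0_iff) blast
  moreover have k3: "3 \<le> cov (flip k (flip j u))"
    using cov_code_ge_card[OF jk star_pair_dirs[OF j k(1,2)]] k by simp
  have "1 - 1 / real (cov (flip j u)) + (\<Sum>i\<in>{j, k}. gain (flip j u) i) \<le> loss (flip j u)"
    using j k star_cov k3 by (intro loss_ge[OF c]) auto
  ultimately show ?thesis using self_loss_ge[OF _ c] starD(8)[OF st, of j] k cov_ge3_gain[OF k3]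
    by simp
qed

text \<open>A codeword at distance 3 from the centre is a third cover of both
  \<open>flip k (flip j u)\<close> and \<open>flip l (flip j u)\<close>, each adding 1/6.\<close>

lemma star_loss_triple:
  assumes j: "j < n" "j \<noteq> a" and k: "k < n" "k \<noteq> a" and l: "l < n" "l \<noteq> a"
    and d: "j \<noteq> k" "j \<noteq> l" "k \<noteq> l" and jkl: "flip l (flip k (flip j u)) \<in> C"
  shows "star_gain + 1 / 3 \<le> loss (flip j u)"
    and "3 \<le> cov (flip k (flip j u))"
proof -
  note c = starD(7)[OF st j]
  have "{j, k, l} \<subseteq> dirs (flip k (flip j u))"
    using star_pair_dirs[OF j k] l jkl by (auto simp: dirs_iff)
  then show k3: "3 \<le> cov (flip k (flip j u))"
    using cov_ge_card[of "{j, k, l}" "flip k (flip j u)"] d by auto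
  have "{j, k, l} \<subseteq> dirs (flip l (flip j u))"
    using star_pair_dirs[OF j l] k jkl by (auto simp: dirs_iff flip_commute)
  then have l3: "3 \<le> cov (flip l (flip j u))"
    using cov_ge_card[of "{j, k, l}" "flip l (flip j u)"] d by auto
  have "1 - 1 / real (cov (flip j u)) + (\<Sum>i\<in>{j, k, l}. gain (flip j u) i) \<le> loss (flip j u)"
    using j k l star_cov k3 l3 by (intro loss_ge[OF c]) auto
  then show "star_gain + 1 / 3 \<le> loss (flip j u)"
    using self_loss_nonneg[OF c] starD(8)[OF st, of j] d cov_ge3_gain[OF k3] cov_ge3_gain[OF l3]
    by simp
qed

text \<open>If none of the four cases occurs, \<open>flip j u\<close> is isolated with a private
  neighbour in direction \<open>a\<close>, and each other \<open>flip k (flip j u)\<close> is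
  covered by \<open>flip j u\<close> and \<open>flip k u\<close> only, so \<open>flip j u\<close> is
  high.\<close>

lemma star_not_high_cases:
  assumes j: "j < n" "j \<noteq> a" and nh: "\<not> high a j (flip j u)"
  obtains "flip a (flip j u) \<in> C"
  | "flip a (flip j u) \<notin> C" "cov (flip a (flip j u)) \<noteq> 1"
  | k where "k < n" "k \<noteq> a" "j \<noteq> k" "flip k (flip j u) \<in> C"
  | k l where "k < n" "k \<noteq> a" "l < n" "l \<noteq> a" "j \<noteq> k" "j \<noteq> l" "k \<noteq> l"
      "flip l (flip k (flip j u)) \<in> C"
proof -
  note c = starD(7)[OF st j] and an = starD(3)[OF st]
  have "high a j (flip j u)"
    if A: "flip a (flip j u) \<notin> C" and B: "cov (flip a (flip j u)) = 1"
      and Cc: "\<And>k. k < n \<Longrightarrow> k \<noteq> a \<Longrightarrow> j \<noteq> k \<Longrightarrow> flip k (flip j u) \<notin> C"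
      and Dd: "\<And>k l. k < n \<Longrightarrow> k \<noteq> a \<Longrightarrow> l < n \<Longrightarrow> l \<noteq> a \<Longrightarrow> j \<noteq> k \<Longrightarrow> j \<noteq> l \<Longrightarrow> k \<noteq> l \<Longrightarrow>
        flip l (flip k (flip j u)) \<notin> C"
  proof -
    have "dirs (flip j u) = {}"
    proof -
      have "flip k (flip j u) \<notin> C" if "k < n" for k
        using A Cc[OF that] starD(2)[OF st] by (cases "k = j"; cases "k = a") auto
      then show ?thesis by (auto simp: dirs_def)
    qed
    then have "cov (flip j u) = 1" using c by (simp add: cov_def)
    moreover have "cov (flip k (flip j u)) = 2" if k: "k < n" "k \<noteq> a" "k \<noteq> j" for k
    proof -
      have nc: "flip k (flip j u) \<notin> C" using Cc k by auto
      have "l = j \<or> l = k" if l: "l \<in> dirs (flip k (flip j u))" for l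
      proof (rule ccontr)
        assume ne: "\<not> (l = j \<or> l = k)"
        have ln: "l < n" "flip l (flip k (flip j u)) \<in> C" using l by (auto simp: dirs_iff)
        have "l = a" using Dd[OF k(1,2) ln(1)] ne k ln by blast
        then have "k \<in> dirs (flip a (flip j u))" using ln k by (simp add: dirs_iff flip_commute)
        then show False using private_noncode(2)[OF c an B] k by simp
      qed
      then have "dirs (flip k (flip j u)) = {j, k}" using star_pair_dirs[OF j k(1,2)] by blast
      then show ?thesis using nc k by (simp add: cov_noncode)
    qed
    ultimately show ?thesis using c j an B starD(5)[OF st] by (simp add: high_def)
  qed
  then show ?thesis using that nh by blast
qed

lemma star_not_high_loss:
  assumes j: "j < n" "j \<noteq> a" and nh: "\<not> high a j (flip j u)"
  shows "star_gain + 1 / 3 \<le> loss (flip j u)"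
  using star_not_high_cases[OF assms]
proof cases
  case 1
  then show ?thesis using star_loss_code[OF j] by linarith
next
  case 2
  then show ?thesis using star_loss_not_private[OF j] by linarith
next
  case (3 k)
  then show ?thesis using star_loss_pair[OF j] by force
next
  case (4 k l)
  then show ?thesis using star_loss_triple(1)[OF j] by blast
qed

text \<open>The member \<open>flip b u\<close> has surplus 1 and the member \<open>flip j u\<close>
  has 2/3, except in the triple case; there \<open>j\<close>, \<open>k\<close> and \<open>l\<close>
  have 1/3 each, and at least two of them differ from \<open>b\<close>.\<close>

lemma star_sum_loss_ge:
  assumes b: "b < n" "b \<noteq> a" "flip a (flip b u) \<in> C"
    and nt: "j < n" "j \<noteq> a" "j \<noteq> b" "\<not> high a j (flip j u)"
  shows "(real n - 1) * star_gain + 5 / 3 \<le> (\<Sum>i\<in>dirs u. loss (flip i u))"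
proof -
  let ?E = "\<lambda>i. loss (flip i u) - star_gain"
  have E0: "0 \<le> ?E i" if "i < n" "i \<noteq> a" for i using star_loss_ge[OF that] by simp
  have Eb: "1 \<le> ?E b" using star_loss_code[OF b] by linarith
  have sub: "(\<Sum>i\<in>S. ?E i) \<le> (\<Sum>i\<in>dirs u. ?E i)" if "S \<subseteq> dirs u" for S
    using that E0 starD(4)[OF st] by (intro sum_mono2) auto
  have "5 / 3 \<le> (\<Sum>i\<in>dirs u. ?E i)"
  proof -
    have two: "5 / 3 \<le> (\<Sum>i\<in>dirs u. ?E i)" if "star_gain + 2 / 3 \<le> loss (flip j u)"
      using sub[of "{b, j}"] that Eb nt b starD(4)[OF st] by simp
    show ?thesis using star_not_high_cases[OF nt(1,2,4)]
    proof cases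
      case 1
      then show ?thesis using star_loss_code[OF nt(1,2)] two by linarith
    next
      case 2
      then show ?thesis using star_loss_not_private[OF nt(1,2)] two by linarith
    next
      case (3 k)
      then show ?thesis using star_loss_pair[OF nt(1,2)] two by force
    next
      case (4 k l)
      have Ej: "1 / 3 \<le> ?E j" using star_loss_triple(1)[OF nt(1,2) 4(1-8)] by linarith
      have Ek: "1 / 3 \<le> ?E k"
        using star_loss_triple(1)[OF 4(1,2) nt(1,2) 4(3,4)] 4 by (simp add: flip_commute)
      have El: "1 / 3 \<le> ?E l"
        using star_loss_triple(1)[OF 4(3,4) nt(1,2) 4(1,2)] 4 by (simp add: flip_commute)
      consider "k = b" | "l = b" | "k \<noteq> b" "l \<noteq> b" by blast
      then show ?thesis
      proof cases
        case 1
        then show ?thesis using sub[of "{j, b, l}"] 4 nt b Ej El Eb starD(4)[OF st] by simp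
      next
        case 2
        then show ?thesis using sub[of "{j, b, k}"] 4 nt b Ej Ek Eb starD(4)[OF st] by simp
      next
        case 3
        then show ?thesis using sub[of "{j, k, l, b}"] 4 nt b Ej Ek El Eb starD(4)[OF st] by simp
      qed
    qed
  qed
  then show ?thesis using starD(3)[OF st] n_ge by (simp add: sum_subtractf starD(4)[OF st] of_nat_diff)
qed

end

section \<open>Discharging\<close>

text \<open>The threshold admits star centres, with \<open>cov\<close> n - 1, as well as second
  centres, with \<open>cov\<close> n - 2.\<close>

definition big :: "'a \<Rightarrow> nat set" where
  "big c = {i. i < n \<and> flip i c \<notin> C \<and> n - 2 \<le> cov (flip i c)}"

text \<open>With one big neighbour the entire surplus is handed over, even if negative; with
  several, 1/20 to each is affordable by \<open>loss_ge_big\<close>.\<close>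

definition pay :: "'a \<Rightarrow> real" where
  "pay c = (if card (big c) = 1 then loss c - \<theta> else 1 / 20)"

lemma finite_big [simp]: "finite (big c)"
  by (simp add: big_def)

lemma big_gain:
  assumes "i \<in> big c"
  shows "1 / 6 + 1 / 20 \<le> gain c i"
proof -
  have "9 \<le> cov (flip i c)" using assms n_ge by (auto simp: big_def)
  then have "1 / real (cov (flip i c)) \<le> 1 / 9" by (intro divide_left_mono) auto
  then show ?thesis by (simp add: gain_def)
qed

text \<open>Two big neighbours \<open>flip i c\<close> and \<open>flip j c\<close> share at least n
  - 4 directions \<open>k\<close>. Each such \<open>flip k c\<close> is big or covered by
  \<open>c\<close>, \<open>flip k (flip i c)\<close> and \<open>flip k (flip j c)\<close>, hence
  gains 1/6. These sixths exceed \<theta> and leave 1/20 per big neighbour.\<close>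

lemma loss_ge_big:
  assumes c: "c \<in> C" and two: "2 \<le> card (big c)"
  shows "\<theta> + real (card (big c)) / 20 \<le> loss c"
proof -
  obtain i j where ij: "i \<in> big c" "j \<in> big c" "i \<noteq> j"
    using two card_le_Suc0_iff_eq[of "big c"] by fastforce
  define X where "X = dirs (flip i c) \<inter> dirs (flip j c)"
  have fX: "finite X" by (simp add: X_def)
  have "card (dirs (flip i c)) + card (dirs (flip j c))
    = card (dirs (flip i c) \<union> dirs (flip j c)) + card X"
    unfolding X_def by (rule card_Un_Int) auto
  moreover have "card (dirs (flip i c) \<union> dirs (flip j c)) \<le> card {..<n}"
    by (rule card_mono) (auto simp: dirs_iff)
  moreover have "n - 2 \<le> card (dirs (flip i c))" "n - 2 \<le> card (dirs (flip j c))"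
    using ij by (auto simp: big_def cov_noncode)
  ultimately have X: "n - 4 \<le> card X" by simp
  have X3: "3 \<le> cov (flip k c)" if "k \<in> X - big c" for k
  proof -
    have "k < n" "flip k (flip i c) \<in> C" "flip k (flip j c) \<in> C" "k \<noteq> i" "k \<noteq> j"
      using that ij by (auto simp: X_def dirs_iff)
    moreover have "i < n" "j < n" using ij by (auto simp: big_def)
    ultimately have "{k, i, j} \<subseteq> dirs (flip k c)" using c by (auto simp: dirs_iff flip_commute)
    then show ?thesis using cov_ge_card[of "{k, i, j}" "flip k c"] ij \<open>k \<noteq> i\<close> \<open>k \<noteq> j\<close> by simp
  qed
  have B3: "3 \<le> cov (flip k c)" if "k \<in> big c" for k using that n_ge by (auto simp: big_def)
  have "1 - 1 / real (cov c) + (\<Sum>k\<in>big c \<union> (X - big c). gain c k) \<le> loss c"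
  proof (intro loss_ge[OF c])
    show "2 \<le> cov (flip k c)" if "k \<in> big c \<union> (X - big c)" for k
      using that X3[of k] B3[of k] by force
  qed (auto simp: big_def X_def dirs_iff)
  moreover have "(\<Sum>k\<in>big c \<union> (X - big c). gain c k)
      = (\<Sum>k\<in>big c. gain c k) + (\<Sum>k\<in>X - big c. gain c k)"
    using fX by (intro sum.union_disjoint) auto
  moreover have "real (card (big c)) * (1 / 6 + 1 / 20) \<le> (\<Sum>k\<in>big c. gain c k)"
    using big_gain by (intro sum_bounded_below) auto
  moreover have "real (card (X - big c)) * (1 / 6) \<le> (\<Sum>k\<in>X - big c. gain c k)"
    using X3 cov_ge3_gain by (intro sum_bounded_below) auto
  moreover have "real n - 4 \<le> real (card (big c)) + real (card (X - big c))"
  proof -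
    have "card X \<le> card (big c \<union> (X - big c))" using fX by (intro card_mono) auto
    also have "\<dots> \<le> card (big c) + card (X - big c)" by (rule card_Un_le)
    finally show ?thesis using X by linarith
  qed
  ultimately show ?thesis using self_loss_nonneg[OF c] \<theta>_le_two_thirds n_ge by (simp add: field_simps)
qed

lemma high_big:
  assumes "high a j c"
  shows "big c = {j}"
proof -
  have "flip j c \<notin> C" using starD(2)[OF high_star[OF assms]] .
  then have "j \<in> big c" using assms by (simp add: big_def high_def)
  moreover have "i = j" if "i \<in> big c" for i
  proof (rule ccontr)
    assume "i \<noteq> j"
    then have "cov (flip i c) \<le> 2" using that assms by (cases "i = a") (auto simp: high_def big_def)
    moreover have "n - 2 \<le> cov (flip i c)" using that by (simp add: big_def)
    ultimately show False using n_ge by linarith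
  qed
  ultimately show ?thesis by blast
qed

lemma pay_nonneg:
  assumes "c \<in> C" "\<And>a j. \<not> high a j c"
  shows "0 \<le> pay c"
  using loss_ge_or_high[OF assms(1)] assms(2) by (auto simp: pay_def)

lemma star_big: "star a u \<Longrightarrow> j < n \<Longrightarrow> j \<in> big (flip j u)"
  using starD[of a u] by (simp add: big_def)

text \<open>Let \<open>flip k (flip j u)\<close> be a second big neighbour of
  \<open>flip j u\<close>. For each of its directions \<open>h\<close> other than \<open>j\<close>,
  the word \<open>flip j (flip h u)\<close> has a third cover or is that big word itself, so
  \<open>flip h u\<close> is not high. At most two directions are missing from the big word.\<close>

lemma star_shared_member:
  assumes st: "star a u" and j: "j < n" "j \<noteq> a" "card (big (flip j u)) \<noteq> 1"
  shows "card {h \<in> dirs u. high a h (flip h u)} \<le> 2"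
proof -
  have "big (flip j u) \<noteq> {j}" using j by auto
  then obtain k where k: "k \<in> big (flip j u)" "k \<noteq> j" using star_big[OF st j(1)] by blast
  have kn: "k < n" "flip k (flip j u) \<notin> C" "n - 2 \<le> cov (flip k (flip j u))"
    using k by (auto simp: big_def)
  have sub: "{h \<in> dirs u. high a h (flip h u)} \<subseteq> {..<n} - dirs (flip k (flip j u))"
  proof
    fix h assume "h \<in> {h \<in> dirs u. high a h (flip h u)}"
    then have h: "h < n" "h \<noteq> a" "high a h (flip h u)" using starD(4)[OF st] by auto
    have hj: "h \<noteq> j" using high_big[OF h(3)] j(3) by auto
    have h2: "cov (flip j (flip h u)) = 2" using h(3) j hj by (auto simp: high_def)
    have "h \<notin> dirs (flip k (flip j u))"
    proof
      assume hd: "h \<in> dirs (flip k (flip j u))"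
      show False
      proof (cases "h = k")
        case True
        then show False using h2 kn n_ge by (simp add: flip_commute)
      next
        case False
        have "{j, h, k} \<subseteq> dirs (flip j (flip h u))"
          using star_pair_dirs[OF st h(1,2) j(1,2)] hd kn by (auto simp: dirs_iff flip_commute)
        then show False using cov_ge_card[of "{j, h, k}"] h2 hj k False by fastforce
      qed
    qed
    then show "h \<in> {..<n} - dirs (flip k (flip j u))" using h by simp
  qed
  have "card {h \<in> dirs u. high a h (flip h u)} \<le> card ({..<n} - dirs (flip k (flip j u)))"
    using sub by (intro card_mono) auto
  also have "\<dots> = n - card (dirs (flip k (flip j u)))"
    by (subst card_Diff_subset) (auto simp: dirs_iff)
  also have "\<dots> \<le> 2" using kn by (simp add: cov_noncode)
  finally show ?thesis .
qed

text \<open>The codeword compensating for a tight star is \<open>flip a (flip b u)\<close>; \<open>second a b u j\<close> says that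
  its neighbour in direction \<open>j\<close> is the centre of a second star.\<close>

definition tight :: "nat \<Rightarrow> nat \<Rightarrow> 'a \<Rightarrow> bool" where
  "tight a b u \<longleftrightarrow> star a u \<and> b < n \<and> b \<noteq> a \<and> flip a (flip b u) \<in> C \<and>
     (\<forall>j<n. j \<noteq> a \<longrightarrow> j \<noteq> b \<longrightarrow> high a j (flip j u))"

definition second :: "nat \<Rightarrow> nat \<Rightarrow> 'a \<Rightarrow> nat \<Rightarrow> bool" where
  "second a b u j \<longleftrightarrow> j < n \<and> j \<noteq> a \<and> j \<noteq> b \<and>
     dirs (flip j (flip a (flip b u))) = {..<n} - {a, b}"

section \<open>The neighbourhood of a tight star\<close>

lemma high_isolated: "high a j c \<Longrightarrow> k < n \<Longrightarrow> flip k c \<notin> C"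
  using cov1_dirs[of c] by (auto simp: high_def dirs_def)

lemma high_private_dirs: "high a j c \<Longrightarrow> dirs (flip a c) = {a}"
  using private_noncode(2)[of c a] by (auto simp: high_def)

context
  fixes a b u assumes ti: "tight a b u"
begin

lemma tight_star: "star a u" and tight_b: "b < n" "b \<noteq> a" "flip a (flip b u) \<in> C"
  and tight_high: "\<And>j. j < n \<Longrightarrow> j \<noteq> a \<Longrightarrow> j \<noteq> b \<Longrightarrow> high a j (flip j u)"
  using ti by (auto simp: tight_def)

lemma tight_a: "a < n"
  using starD(3)[OF tight_star] .

lemma tight_pair:
  assumes "k < n" "k \<noteq> a" "k \<noteq> b" "l < n"
  shows "flip k (flip l u) \<notin> C"
  using high_isolated[OF tight_high[OF assms(1-3)] assms(4)] by (simp add: flip_commute)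

text \<open>The high member \<open>flip k u\<close> is the only cover of its private neighbour
  \<open>flip a (flip k u)\<close>.\<close>

lemma tight_triple_a:
  assumes "k < n" "k \<noteq> a" "k \<noteq> b" "l < n" "l \<noteq> a"
  shows "flip l (flip k (flip a u)) \<notin> C"
proof
  assume "flip l (flip k (flip a u)) \<in> C"
  then have "l \<in> dirs (flip a (flip k u))" using assms by (simp add: dirs_iff flip_commute)
  then show False using high_private_dirs[OF tight_high[OF assms(1-3)]] assms by simp
qed

text \<open>Such a codeword would be a third cover of \<open>flip l (flip k u)\<close>, which is
  covered only twice because \<open>flip k u\<close> is high.\<close>

lemma tight_triple_b:
  assumes k: "k < n" "k \<noteq> a" "k \<noteq> b" and l: "l < n" "l \<noteq> a" "l \<noteq> b" "k \<noteq> l"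
  shows "flip l (flip k (flip b u)) \<notin> C"
proof
  assume "flip l (flip k (flip b u)) \<in> C"
  then have "3 \<le> cov (flip l (flip k u))"
    using star_loss_triple(2)[OF tight_star k(1,2) l(1,2) tight_b(1,2)] k l by (simp add: flip_commute)
  moreover have "cov (flip l (flip k u)) = 2"
    using tight_high[OF k] l by (auto simp: high_def)
  ultimately show False by simp
qed

lemma tight_private: "flip a u \<notin> C" "dirs (flip a u) = {b}" "cov (flip a u) = 1"
proof -
  show nc: "flip a u \<notin> C" using starD(6)[OF tight_star] .
  have "k = b" if "k < n" "flip k (flip a u) \<in> C" for k
  proof (rule ccontr)
    assume kb: "k \<noteq> b"
    have "k \<noteq> a" using that(2) starD(2)[OF tight_star] by auto
    then show False using tight_pair[OF that(1) _ kb tight_a] that(2) by blast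
  qed
  moreover have "flip b (flip a u) \<in> C" using tight_b by (simp add: flip_commute)
  ultimately show d: "dirs (flip a u) = {b}" using tight_b(1) by (intro dirs_singleton)
  then show "cov (flip a u) = 1" using nc by (simp add: cov_noncode)
qed

lemma tight_code_nbr: "flip b u \<in> C" "cov (flip b u) = 2"
proof -
  show c: "flip b u \<in> C" using starD(7)[OF tight_star] tight_b by blast
  have "k = a" if "k < n" "flip k (flip b u) \<in> C" for k
  proof (rule ccontr)
    assume kb: "k \<noteq> a"
    have "k \<noteq> b" using that(2) starD(2)[OF tight_star] by auto
    then show False using tight_pair[OF that(1) kb _ tight_b(1)] that(2) by blast
  qed
  then have "dirs (flip b u) = {a}" using tight_b(3) tight_a by (intro dirs_singleton)
  then show "cov (flip b u) = 2" using c by (simp add: cov_def)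
qed

lemma tight_codeword: "dirs (flip a (flip b u)) = {a}" "cov (flip a (flip b u)) = 2"
proof -
  have "k = a" if "k < n" "flip k (flip a (flip b u)) \<in> C" for k
  proof (rule ccontr)
    assume "k \<noteq> a"
    moreover have "k \<noteq> b" using that tight_private(1) flip_commute[of a b u] by auto
    ultimately show False
      using tight_triple_a[OF that(1) _ _ tight_b(1,2)] that by (simp add: flip_commute)
  qed
  moreover have "flip a (flip a (flip b u)) \<in> C" using tight_code_nbr by simp
  ultimately show d: "dirs (flip a (flip b u)) = {a}" using tight_a by (intro dirs_singleton)
  then show "cov (flip a (flip b u)) = 2" using tight_b by (simp add: cov_def)
qed

lemma tight_codeword_private: "cov (flip b (flip a (flip b u))) = 1"
  using tight_private(3) flip_commute[of b a "flip b u"] by simp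

lemma tight_codeword_nbr:
  assumes k: "k < n" "k \<noteq> a" "k \<noteq> b"
  shows "flip k (flip a (flip b u)) \<notin> C"
    "dirs (flip k (flip a (flip b u))) \<subseteq> {..<n} - {a, b}"
    "2 \<le> cov (flip k (flip a (flip b u)))" "cov (flip k (flip a (flip b u))) \<le> n - 2"
proof -
  let ?c = "flip a (flip b u)"
  show nc: "flip k ?c \<notin> C" using tight_codeword k by (auto simp: dirs_def)
  have "flip a (flip k ?c) = flip k (flip b u)" by (simp add: flip_commute[of a k])
  then have "a \<notin> dirs (flip k ?c)" using tight_pair[OF k tight_b(1)] by (simp add: dirs_iff)
  moreover have "flip b (flip k ?c) = flip k (flip a u)"
    by (simp add: flip_commute[of b k] flip_commute[of b a])
  then have "b \<notin> dirs (flip k ?c)" using tight_pair[OF k tight_a] by (simp add: dirs_iff)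
  ultimately show sub: "dirs (flip k ?c) \<subseteq> {..<n} - {a, b}" by (auto simp: dirs_iff)
  have "cov (flip k ?c) \<noteq> 1"
    using private_eq[OF tight_b(3) k(1) _ tight_b(1) tight_codeword_private] k by blast
  moreover have "1 \<le> cov (flip k ?c)" using cov_pos tight_b(3) code_in_W flip_in_W by blast
  ultimately show "2 \<le> cov (flip k ?c)" by linarith
  have "card (dirs (flip k ?c)) \<le> card ({..<n} - {a, b})" using sub by (intro card_mono) auto
  also have "\<dots> = n - 2" using tight_a tight_b by (simp add: card_Diff_subset)
  finally show "cov (flip k ?c) \<le> n - 2" using nc by (simp add: cov_noncode)
qed

lemma tight_codeword_noncode_nbr:
  assumes "i < n" "flip i (flip a (flip b u)) \<notin> C"
  shows "cov (flip i (flip a (flip b u))) \<le> n - 2"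
  using assms tight_codeword_nbr(4)[of i] tight_codeword_private tight_code_nbr n_ge
  by (cases "i = a"; cases "i = b") auto

text \<open>The code neighbour \<open>flip b u\<close> gives 1/2, and n - 2 directions remain
  besides \<open>a\<close> and \<open>b\<close>. Two heavy neighbours add 2/3 - 1/(n - 5), by
  \<open>sum_half_minus_inverse_ge\<close> with N = n - 2; a single one must contain all n - 2
  directions, so it is a second centre, with gain 1/2 - 1/(n - 2).\<close>

lemma tight_loss:
  "7 / 6 - 1 / (real n - 5) \<le> loss (flip a (flip b u)) \<or>
   1 - 1 / (real n - 2) \<le> loss (flip a (flip b u)) \<and> (\<exists>j. second a b u j)"
proof -
  let ?c = "flip a (flip b u)"
  define Q where "Q = {i. i < n \<and> 3 \<le> cov (flip i ?c)}"
  have finQ: "finite Q" by (simp add: Q_def)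
  have "card ({..<n} - {a, b}) \<le> (\<Sum>j\<in>Q. cov (flip j ?c))"
    using tight_codeword_nbr by (intro card_le_sum_cov[OF tight_b(3) _ _ _ Q_def]) auto
  then have sumQ: "n - 2 \<le> (\<Sum>j\<in>Q. cov (flip j ?c))"
    using tight_a tight_b by (simp add: card_Diff_subset)
  have lossQ: "1 / 2 + (\<Sum>i\<in>Q. gain ?c i) \<le> loss ?c"
  proof -
    have "1 - 1 / real (cov ?c) + (\<Sum>i\<in>Q. gain ?c i) \<le> loss ?c"
      by (rule loss_ge[OF tight_b(3)]) (auto simp: Q_def)
    then show ?thesis using tight_codeword(2) by simp
  qed
  consider "card Q = 0" | "card Q = 1" | "2 \<le> card Q" by linarith
  then show ?thesis
  proof cases
    case 1
    then show ?thesis using finQ sumQ n_ge by simp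
  next
    case 2
    then obtain j where j: "Q = {j}" by (auto simp: card_1_singleton_iff)
    then have jn: "j < n" "3 \<le> cov (flip j ?c)" by (auto simp: Q_def)
    have ja: "j \<noteq> a" using jn tight_code_nbr by auto
    have jb: "j \<noteq> b" using jn tight_codeword_private by auto
    note t = tight_codeword_nbr[OF jn(1) ja jb]
    have cj: "cov (flip j ?c) = n - 2" using t(4) sumQ j by simp
    have "dirs (flip j ?c) = {..<n} - {a, b}"
    proof (rule card_subset_eq)
      show "card (dirs (flip j ?c)) = card ({..<n} - {a, b})"
        using cj t(1) tight_a tight_b by (simp add: cov_noncode card_Diff_subset)
    qed (use t in auto)
    then have "second a b u j" using jn ja jb by (simp add: second_def)
    moreover have "1 - 1 / (real n - 2) \<le> loss ?c"
      using lossQ j cj n_ge by (simp add: gain_def of_nat_diff)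
    ultimately show ?thesis by blast
  next
    case 3
    have "2 / 3 - 1 / (real (n - 2) - 3) \<le> (\<Sum>j\<in>Q. 1 / 2 - 1 / real (cov (flip j ?c)))"
      using sumQ n_ge 3 by (intro sum_half_minus_inverse_ge[OF finQ]) (auto simp: Q_def)
    moreover have "real (n - 2) - 3 = real n - 5" using n_ge by simp
    ultimately show ?thesis using lossQ by (simp add: gain_def)
  qed
qed

text \<open>Directions \<open>a\<close> and \<open>b\<close> lead to noncodewords, at most one of
  them private. The other is heavy or has a heavy partner, which adds 1/6 to the gain of the centre
  \<open>w\<close>.\<close>

lemma second_member:
  assumes s: "second a b u j" and k: "k < n" "k \<noteq> a" "k \<noteq> b" "k \<noteq> j"
  defines "w \<equiv> flip j (flip a (flip b u))"
  shows "flip k w \<in> C" "flip a (flip k w) \<notin> C" "flip b (flip k w) \<notin> C"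
    "2 / 3 - 1 / (real n - 2) \<le> loss (flip k w)"
proof -
  have j: "j < n" "j \<noteq> a" "j \<noteq> b" and dw: "dirs w = {..<n} - {a, b}"
    using s by (auto simp: second_def w_def)
  have wC: "w \<notin> C" using tight_codeword_nbr(1)[OF j] by (simp add: w_def)
  have "k \<in> dirs w" using k dw by simp
  then show c: "flip k w \<in> C" by (simp add: dirs_iff)
  have "flip a (flip k w) = flip k (flip j (flip b u))"
    by (simp add: w_def flip_commute[of a k] flip_commute[of a j])
  then show A: "flip a (flip k w) \<notin> C" using tight_triple_b[OF j k(1-3)] k by simp
  have "flip b (flip k w) = flip k (flip j (flip a u))"
    by (simp add: w_def flip_commute[of b k] flip_commute[of b j] flip_commute[of b a])
  then show B: "flip b (flip k w) \<notin> C" using tight_triple_a[OF j k(1,2)] by simp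
  obtain y where y: "y = a \<or> y = b" "cov (flip y (flip k w)) \<noteq> 1"
    using private_eq[OF c tight_a _ tight_b(1)] tight_b(2) by blast
  have yn: "y < n" "y \<noteq> k" "flip y (flip k w) \<notin> C" using y A B k tight_a tight_b by auto
  have "2 \<le> cov (flip y (flip k w))"
    using y(2) cov_pos[of "flip y (flip k w)"] c code_in_W flip_in_W by fastforce
  then obtain l where l: "l < n" "l \<noteq> k" "3 \<le> cov (flip l (flip k w))"
  proof (cases "cov (flip y (flip k w)) = 2")
    case True
    then obtain l where l: "l < n" "3 \<le> cov (flip l (flip k w))" "l \<in> dirs (flip y (flip k w))"
      using leaf_partner[OF c yn(1,3)] by metis
    \<comment> \<open>The heavy neighbour must differ from \<open>w\<close>, whose gain is counted
      separately; \<open>w\<close> has no code neighbour in direction \<open>y\<close>.\<close>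
    have "l \<noteq> k"
    proof
      assume "l = k"
      then have "flip y w \<in> C" using l(3) flip_commute[of k y "flip k w"] by (simp add: dirs_iff)
      then have "y \<in> dirs w" using yn by (simp add: dirs_iff)
      then show False using dw y by auto
    qed
    then show ?thesis using that l by blast
  qed (use that[of y] yn in auto)
  have cw: "cov w = n - 2" using wC dw tight_a tight_b by (simp add: cov_noncode card_Diff_subset)
  have "1 - 1 / real (cov (flip k w)) + (\<Sum>i\<in>{k, l}. gain (flip k w) i) \<le> loss (flip k w)"
    using k l cw n_ge by (intro loss_ge[OF c]) auto
  moreover have "gain (flip k w) k = 1 / 2 - 1 / (real n - 2)"
    using cw n_ge by (simp add: gain_def of_nat_diff)
  ultimately show "2 / 3 - 1 / (real n - 2) \<le> loss (flip k w)"
    using self_loss_nonneg[OF c] cov_ge3_gain[OF l(3)] l by simp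
qed

lemma tight_sum_loss: "(real n - 1) * star_gain + 1 \<le> (\<Sum>i\<in>dirs u. loss (flip i u))"
proof -
  have "(\<Sum>i\<in>dirs u. star_gain + (if i = b then 1 else 0)) \<le> (\<Sum>i\<in>dirs u. loss (flip i u))"
    using starD(4)[OF tight_star] star_loss_ge[OF tight_star]
      star_loss_code[OF tight_star tight_b] by (intro sum_mono) auto
  moreover have "(\<Sum>i\<in>dirs u. star_gain + (if i = b then 1 else 0)) = (real n - 1) * star_gain + 1"
    using tight_a tight_b n_ge by (simp add: sum.distrib starD(4)[OF tight_star] of_nat_diff)
  ultimately show ?thesis by simp
qed

end

text \<open>In the compensating codeword, \<open>a\<close> is the only code direction and
  \<open>b\<close> the private direction.\<close>

lemma tight_determined:
  assumes t: "tight a b u" "tight a' b' u'" and eq: "flip a (flip b u) = flip a' (flip b' u')"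
  shows "a = a'" "b = b'" "u = u'"
proof -
  show a: "a = a'" using tight_codeword(1)[OF t(1)] tight_codeword(1)[OF t(2)] eq by simp
  show b: "b = b'"
    using private_eq[OF tight_b(3)[OF t(1)] tight_b(1)[OF t(1)] tight_codeword_private[OF t(1)]
        tight_b(1)[OF t(2)]] tight_codeword_private[OF t(2)] eq by simp
  show "u = u'" using eq a b by (metis flip_flip)
qed

lemma tight_star_determined:
  assumes t: "tight a b u" "tight a' b' u"
  shows "a = a'" "b = b'"
proof -
  have "{..<n} - {a} = {..<n} - {a'}"
    using starD(4)[OF tight_star[OF t(1)]] starD(4)[OF tight_star[OF t(2)]] by simp
  then show a: "a = a'" using tight_a[OF t(1)] tight_a[OF t(2)] by blast
  show "b = b'" using tight_private(2)[OF t(1)] tight_private(2)[OF t(2)] a by simp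
qed

section \<open>Receipts at big words\<close>

definition tight_codewords :: "'a set" where
  "tight_codewords = {flip a (flip b u) |a b u. tight a b u}"

text \<open>Every codeword that is not tight sends \<^term>\<open>pay\<close> to each of its big neighbours.\<close>

definition receipt :: "'a \<Rightarrow> real" where
  "receipt v = (\<Sum>i\<in>{i \<in> dirs v. flip i v \<notin> tight_codewords}. pay (flip i v))"

text \<open>Noncode neighbours of a tight codeword have \<open>cov\<close> at most n - 2, a star
  centre has n - 1. Hence a star centre receives \<open>pay\<close> from all its members.\<close>

lemma star_member_not_tight:
  assumes st: "star a u" and j: "j < n" "j \<noteq> a"
  shows "flip j u \<notin> tight_codewords"
proof
  assume "flip j u \<in> tight_codewords"
  then obtain a' b' u' where t: "tight a' b' u'" and eq: "flip j u = flip a' (flip b' u')"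
    by (auto simp: tight_codewords_def)
  have "flip j (flip a' (flip b' u')) = u" using eq[symmetric] by simp
  then show False
    using tight_codeword_noncode_nbr[OF t j(1)] starD(2,5)[OF st] n_ge by simp
qed

lemma receipt_star:
  assumes st: "star a u"
  shows "receipt u = (\<Sum>i\<in>dirs u. pay (flip i u))"
proof -
  have "{i \<in> dirs u. flip i u \<notin> tight_codewords} = dirs u"
    using star_member_not_tight[OF st] starD(4)[OF st] by auto
  then show ?thesis by (simp add: receipt_def)
qed

lemma receipt_star_unshared:
  assumes st: "star a u" and un: "\<And>i. i \<in> dirs u \<Longrightarrow> card (big (flip i u)) = 1"
  shows "receipt u = (\<Sum>i\<in>dirs u. loss (flip i u)) - (real n - 1) * \<theta>"
proof -
  have "card (dirs u) = n - 1" using starD(3,4)[OF st] by simp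
  moreover have "receipt u = (\<Sum>i\<in>dirs u. loss (flip i u) - \<theta>)"
    unfolding receipt_star[OF st] using un by (intro sum.cong) (auto simp: pay_def)
  ultimately show ?thesis using n_ge by (simp add: sum_subtractf of_nat_diff)
qed

text \<open>If every member has \<open>u\<close> as its only big neighbour, the surplus 5/3 suffices
  by \<open>\<theta>_star\<close>. Otherwise at most two members are high, and the others make up
  for them.\<close>

lemma receipt_star_nonneg:
  assumes st: "star a u" and nt: "\<And>b. \<not> tight a b u"
  shows "0 \<le> receipt u"
proof -
  note s = starD[OF st]
  obtain b where b: "b < n" "flip b (flip a u) \<in> C"
    using dominated[of "flip a u"] s(1,6) flip_in_W by blast
  have ba: "b \<noteq> a" using b s(2) by auto
  have bC: "flip a (flip b u) \<in> C" using b by (simp add: flip_commute)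
  obtain j where j: "j < n" "j \<noteq> a" "j \<noteq> b" "\<not> high a j (flip j u)"
    using nt[of b] st b(1) ba bC by (auto simp: tight_def)
  show ?thesis
  proof (cases "\<forall>i\<in>dirs u. card (big (flip i u)) = 1")
    case True
    then have "receipt u = (\<Sum>i\<in>dirs u. loss (flip i u)) - (real n - 1) * \<theta>"
      using receipt_star_unshared[OF st] by blast
    then show ?thesis using star_sum_loss_ge[OF st b(1) ba bC j] \<theta>_star
        right_diff_distrib[of "real n - 1" \<theta> star_gain] by linarith
  next
    case False
    let ?H = "{h \<in> dirs u. high a h (flip h u)}"
    have H: "card ?H \<le> 2" using False star_shared_member[OF st] s(4) by auto
    have "1 / (real n - 1) \<le> 1 / (real n - 4)" using n_ge by (intro divide_left_mono) auto
    then have \<theta>: "\<theta> \<le> star_gain + 1 / 6" using \<theta>_le by linarith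
    \<comment> \<open>A high member pays at least -1/6 = 1/20 - 13/60, any other at least
      1/20.\<close>
    have "(\<Sum>i\<in>dirs u. 1 / 20 - (if i \<in> ?H then 13 / 60 else 0)) \<le> receipt u"
      unfolding receipt_star[OF st]
    proof (rule sum_mono)
      fix i assume i: "i \<in> dirs u"
      then have i': "i < n" "i \<noteq> a" using s(4) by auto
      show "1 / 20 - (if i \<in> ?H then 13 / 60 else 0) \<le> pay (flip i u)"
        using i \<theta> star_loss_ge[OF st i'] star_not_high_loss[OF st i'] by (auto simp: pay_def)
    qed
    moreover have "(\<Sum>i\<in>dirs u. 1 / 20 - (if i \<in> ?H then 13 / 60 else 0))
        = (real n - 1) / 20 - real (card ?H) * (13 / 60)"
    proof -
      have "(\<Sum>i\<in>dirs u. if i \<in> ?H then 13 / 60 else 0) = (\<Sum>i\<in>?H. 13 / 60 :: real)"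
        by (intro sum.mono_neutral_cong_right) auto
      moreover have "card (dirs u) = n - 1" using s(3,4) by simp
      ultimately show ?thesis using n_ge by (simp add: sum_subtractf of_nat_diff)
    qed
    moreover have "real (card ?H) * (13 / 60) \<le> 2 * (13 / 60)"
      using H by (intro mult_right_mono) auto
    moreover have "10 / 20 \<le> (real n - 1) / 20" using n_ge by simp
    ultimately show ?thesis by linarith
  qed
qed

text \<open>At least n - 2 > 2 members are high, so by \<open>star_shared_member\<close> no member
  has a second big neighbour and all pay their plain surplus.\<close>

lemma receipt_tight:
  assumes t: "tight a b u"
  shows "(real n - 1) * star_gain + 1 - (real n - 1) * \<theta> \<le> receipt u"
proof -
  note st = tight_star[OF t]
  have "card (big (flip i u)) = 1" if "i \<in> dirs u" for i
  proof (rule ccontr)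
    assume "card (big (flip i u)) \<noteq> 1"
    then have "card {h \<in> dirs u. high a h (flip h u)} \<le> 2"
      using star_shared_member[OF st] that starD(4)[OF st] by auto
    moreover have "card ({..<n} - {a, b}) \<le> card {h \<in> dirs u. high a h (flip h u)}"
      using tight_high[OF t] starD(4)[OF st] by (intro card_mono) auto
    moreover have "card ({..<n} - {a, b}) = n - 2"
      using tight_a[OF t] tight_b[OF t] by (simp add: card_Diff_subset)
    ultimately show False using n_ge by linarith
  qed
  then show ?thesis using receipt_star_unshared[OF st] tight_sum_loss[OF t] by simp
qed

text \<open>Only high codewords can pay a negative amount, and their big neighbour is a star
  centre.\<close>

lemma receipt_nonneg:
  assumes v: "v \<in> W" "v \<notin> C" "n - 2 \<le> cov v" and nt: "\<And>a b. \<not> tight a b v"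
  shows "0 \<le> receipt v"
proof (cases "\<exists>i\<in>dirs v. \<exists>a j. high a j (flip i v)")
  case True
  then obtain i a j where i: "i \<in> dirs v" and h: "high a j (flip i v)" by blast
  have "i \<in> big (flip i v)" using i v by (simp add: big_def dirs_iff)
  then have "i = j" using high_big[OF h] by simp
  then have "star a v" using high_star[OF h] by simp
  then show ?thesis using receipt_star_nonneg nt by blast
next
  case False
  then show ?thesis unfolding receipt_def
    by (intro sum_nonneg pay_nonneg) (auto simp: dirs_iff)
qed

text \<open>A tight member with parameters \<open>a'\<close>, \<open>b'\<close> would exclude
  \<open>a'\<close> from the directions of the second centre, so \<open>a'\<close> is
  \<open>a\<close> or \<open>b\<close>; but direction \<open>a'\<close> leads from that member to a
  codeword, against \<open>second_member\<close>.\<close>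

lemma second_member_not_tight:
  assumes t: "tight a b u" and s: "second a b u j" and k: "k < n" "k \<noteq> a" "k \<noteq> b" "k \<noteq> j"
  shows "flip k (flip j (flip a (flip b u))) \<notin> tight_codewords"
proof
  let ?w = "flip j (flip a (flip b u))"
  note m = second_member[OF t s k]
  have j: "j < n" "j \<noteq> a" "j \<noteq> b" and dw: "dirs ?w = {..<n} - {a, b}"
    using s by (auto simp: second_def)
  have wC: "?w \<notin> C" using tight_codeword_nbr(1)[OF t j] .
  have cw: "cov ?w = n - 2"
    using wC dw tight_a[OF t] tight_b[OF t] by (simp add: cov_noncode card_Diff_subset)
  assume "flip k ?w \<in> tight_codewords"
  then obtain a' b' u' where t': "tight a' b' u'" and eq: "flip k ?w = flip a' (flip b' u')"
    by (auto simp: tight_codewords_def)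
  have w: "flip k (flip a' (flip b' u')) = ?w" using eq[symmetric] by simp
  have a'C: "flip a' (flip k ?w) \<in> C" using tight_code_nbr(1)[OF t'] eq by simp
  have "k \<noteq> a'" using a'C wC by auto
  moreover have "k \<noteq> b'" using tight_codeword_private[OF t'] w cw n_ge by auto
  ultimately have "dirs ?w \<subseteq> {..<n} - {a', b'}"
    using tight_codeword_nbr(2)[OF t' k(1)] w by simp
  then have "a' = a \<or> a' = b" using dw tight_a[OF t'] by blast
  then show False using a'C m(2,3) by blast
qed

lemma receipt_second:
  assumes t: "tight a b u" and s: "second a b u j"
  shows "(real n - 3) / 60 \<le> receipt (flip j (flip a (flip b u)))"
proof -
  let ?w = "flip j (flip a (flip b u))"
  have j: "j < n" "j \<noteq> a" "j \<noteq> b" and dw: "dirs ?w = {..<n} - {a, b}"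
    using s by (auto simp: second_def)
  have "flip j ?w \<in> tight_codewords" using t by (auto simp: tight_codewords_def)
  then have S: "{i \<in> dirs ?w. flip i ?w \<notin> tight_codewords} = {..<n} - {a, b, j}"
    unfolding dw using second_member_not_tight[OF t s] by blast
  have "1 / 60 \<le> pay (flip k ?w)" if "k \<in> {..<n} - {a, b, j}" for k
    using second_member(4)[OF t s, of k] that \<theta>_second_star by (auto simp: pay_def)
  then have "real (card ({..<n} - {a, b, j})) * (1 / 60) \<le> receipt ?w"
    unfolding receipt_def S by (intro sum_bounded_below) auto
  moreover have "card ({..<n} - {a, b, j}) = n - 3"
    using tight_a[OF t] tight_b[OF t] j by (subst card_Diff_subset) auto
  ultimately show ?thesis using n_ge by (simp add: of_nat_diff)
qed

text \<open>Selecting one direction lets sums run over tight triples; without a second star the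
  value is arbitrary.\<close>

definition second_center :: "nat \<times> nat \<times> 'a \<Rightarrow> 'a" where
  "second_center = (\<lambda>(a, b, u). flip (SOME j. second a b u j) (flip a (flip b u)))"

lemma second_center_obtain:
  assumes "\<exists>j. second a b u j"
  obtains j where "second a b u j" "second_center (a, b, u) = flip j (flip a (flip b u))"
  using that[OF someI_ex[OF assms]] by (simp add: second_center_def)

lemma second_center_big:
  assumes t: "tight a b u" and s: "\<exists>j. second a b u j"
  shows "second_center (a, b, u) \<in> W" "second_center (a, b, u) \<notin> C"
    "cov (second_center (a, b, u)) = n - 2"
proof -
  obtain j where j: "second a b u j" "second_center (a, b, u) = flip j (flip a (flip b u))"
    using second_center_obtain[OF s] by blast
  have j': "j < n" "j \<noteq> a" "j \<noteq> b" "dirs (flip j (flip a (flip b u))) = {..<n} - {a, b}"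
    using j by (auto simp: second_def)
  show "second_center (a, b, u) \<in> W"
    using j(2) tight_b(3)[OF t] code_in_W flip_in_W by simp
  show nc: "second_center (a, b, u) \<notin> C" using j(2) tight_codeword_nbr(1)[OF t j'(1-3)] by simp
  then show "cov (second_center (a, b, u)) = n - 2"
    using j(2) j'(4) tight_a[OF t] tight_b[OF t] by (simp add: cov_noncode card_Diff_subset)
qed

text \<open>With a common centre, both compensating codewords are tight members of the same second
  star. By \<open>second_member_not_tight\<close> they coincide, and they determine the
  triples.\<close>

lemma second_center_inj:
  assumes t: "tight a b u" "tight a' b' u'"
    and s: "\<exists>j. second a b u j" "\<exists>j. second a' b' u' j"
    and eq: "second_center (a, b, u) = second_center (a', b', u')"
  shows "(a, b, u) = (a', b', u')"
proof -
  obtain j where j: "second a b u j" "second_center (a, b, u) = flip j (flip a (flip b u))"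
    using second_center_obtain[OF s(1)] by blast
  obtain j' where j': "second a' b' u' j'"
    "second_center (a', b', u') = flip j' (flip a' (flip b' u'))"
    using second_center_obtain[OF s(2)] by blast
  let ?w = "flip j (flip a (flip b u))"
  have w: "flip j' ?w = flip a' (flip b' u')" using eq j j' by simp
  have "j' < n" using j' by (simp add: second_def)
  moreover have "flip j' ?w \<in> C" using w tight_b(3)[OF t(2)] by simp
  ultimately have "j' \<in> dirs ?w" by (simp add: dirs_iff)
  then have "j' \<noteq> a" "j' \<noteq> b" "j' < n" using j by (auto simp: second_def)
  moreover have "flip j' ?w \<in> tight_codewords" using w t(2) by (auto simp: tight_codewords_def)
  ultimately have "j' = j" using second_member_not_tight[OF t(1) j(1)] by blast
  then have "flip a (flip b u) = flip a' (flip b' u')" using w by simp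
  then show ?thesis using tight_determined[OF t] by simp
qed

section \<open>The global balance\<close>

lemma sum_pay_eq_sum_receipt:
  "(\<Sum>c\<in>C - tight_codewords. real (card (big c)) * pay c)
    = (\<Sum>v\<in>{v \<in> W. v \<notin> C \<and> n - 2 \<le> cov v}. receipt v)"
proof -
  let ?V = "{v \<in> W. v \<notin> C \<and> n - 2 \<le> cov v}"
  have "(\<Sum>c\<in>C - tight_codewords. real (card (big c)) * pay c)
      = (\<Sum>c\<in>C - tight_codewords. \<Sum>i\<in>big c. pay c)" by simp
  also have "\<dots> = (\<Sum>(c, i)\<in>Sigma (C - tight_codewords) big. pay c)"
    using finite_C by (intro sum.Sigma) auto
  \<comment> \<open>Each incidence is read from its other end: \<open>(c, i)\<close> becomes
    \<open>(flip i c, i)\<close>.\<close>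
  also have "\<dots> = (\<Sum>(v, i)\<in>(SIGMA v:?V. {i \<in> dirs v. flip i v \<notin> tight_codewords}).
      pay (flip i v))"
    by (rule sum.reindex_bij_witness[of _ "\<lambda>(v, i). (flip i v, i)" "\<lambda>(c, i). (flip i c, i)"])
      (auto simp: big_def dirs_iff flip_in_W code_in_W)
  also have "\<dots> = (\<Sum>v\<in>?V. receipt v)"
    unfolding receipt_def using finite_W by (intro sum.Sigma[symmetric]) auto
  finally show ?thesis .
qed

lemma loss_ge_pay:
  assumes c: "c \<in> C"
  shows "real (card (big c)) * pay c \<le> loss c - \<theta>"
proof -
  consider "card (big c) = 0" | "card (big c) = 1" | "2 \<le> card (big c)" by linarith
  then show ?thesis
  proof cases
    case 1
    then have "\<not> high a j c" for a j using high_big[of a j c] by auto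
    then show ?thesis using loss_ge_or_high[OF c] 1 by auto
  next
    case 2
    then show ?thesis by (simp add: pay_def)
  next
    case 3
    then show ?thesis using loss_ge_big[OF c] by (simp add: pay_def)
  qed
qed

text \<open>Tight codewords keep their surplus; the others surrender at most theirs. Receipts can be
  negative only at tight centres, and each of these is matched injectively with its compensating
  codeword and, if there is one, its second centre.\<close>

lemma sum_loss_ge: "real (card C) * \<theta> \<le> (\<Sum>c\<in>C. loss c)"
proof -
  let ?V = "{v \<in> W. v \<notin> C \<and> n - 2 \<le> cov v}"
  define TT where "TT = {(a, b, u). tight a b u}"
  define TS where "TS = {(a, b, u). tight a b u \<and> (\<exists>j. second a b u j)}"
  define cw where "cw = (\<lambda>(a, b, u). flip a (flip b u))"
  define ctr where "ctr = (\<lambda>(a :: nat, b :: nat, u :: 'a). u)"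
  have TS_sub: "TS \<subseteq> TT" by (auto simp: TS_def TT_def)
  have "TT \<subseteq> {..<n} \<times> {..<n} \<times> W"
    using tight_a tight_b(1) tight_star starD(1) by (fastforce simp: TT_def)
  then have finTT: "finite TT" using finite_W finite_subset by blast
  then have finTS: "finite TS" using TS_sub finite_subset by blast
  have cw_image: "cw ` TT = tight_codewords"
    unfolding cw_def TT_def tight_codewords_def by (auto simp: image_iff) blast
  have cw_inj: "inj_on cw TT"
    using tight_determined by (auto simp: inj_on_def TT_def cw_def)
  have ctr_inj: "inj_on ctr TT"
    using tight_star_determined by (auto simp: inj_on_def TT_def ctr_def)
  have sc_inj: "inj_on second_center TS"
  proof (rule inj_onI)
    fix x y assume xy: "x \<in> TS" "y \<in> TS" "second_center x = second_center y"
    obtain a b u where x: "x = (a, b, u)" by (cases x)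
    obtain a' b' u' where y: "y = (a', b', u')" by (cases y)
    show "x = y" using second_center_inj[of a b u a' b' u'] xy unfolding x y TS_def by simp
  qed
  have tc_C: "tight_codewords \<subseteq> C" using tight_b(3) by (auto simp: tight_codewords_def)
  have finV: "finite ?V" using finite_W by simp
  have ctr_V: "ctr ` TT \<subseteq> {v \<in> ?V. cov v = n - 1}"
    using starD(1,2,5)[OF tight_star] by (auto simp: TT_def ctr_def)
  have sc_V: "second_center ` TS \<subseteq> {v \<in> ?V. cov v = n - 2}"
  proof
    fix v assume "v \<in> second_center ` TS"
    then obtain a b u where "tight a b u" "\<exists>j. second a b u j" "v = second_center (a, b, u)"
      by (auto simp: TS_def)
    then show "v \<in> {v \<in> ?V. cov v = n - 2}" using second_center_big[of a b u] by simp
  qed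
  \<comment> \<open>The two kinds of centre differ in \<open>cov\<close>, so no receipt is counted
    twice.\<close>
  have "n - 1 \<noteq> n - 2" using n_ge by simp
  then have disj: "ctr ` TT \<inter> second_center ` TS = {}"
    using ctr_V sc_V by force
  let ?U = "ctr ` TT \<union> second_center ` TS"
  have U_V: "?U \<subseteq> ?V" using ctr_V sc_V by blast
  have "(\<Sum>v\<in>?V. receipt v) = (\<Sum>v\<in>?V - ?U. receipt v) + (\<Sum>v\<in>?U. receipt v)"
    using finV U_V by (rule sum.subset_diff[rotated])
  moreover have "0 \<le> (\<Sum>v\<in>?V - ?U. receipt v)"
  proof (intro sum_nonneg)
    fix v assume v: "v \<in> ?V - ?U"
    have "\<not> tight a b v" for a b
    proof
      assume "tight a b v"
      then have "v \<in> ctr ` TT" unfolding TT_def ctr_def by force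
      then show False using v by blast
    qed
    then show "0 \<le> receipt v" using v by (intro receipt_nonneg) auto
  qed
  moreover have "(\<Sum>v\<in>?U. receipt v) = (\<Sum>t\<in>TT. receipt (ctr t)) + (\<Sum>t\<in>TS. receipt (second_center t))"
    using finTT finTS disj by (simp add: sum.union_disjoint sum.reindex ctr_inj sc_inj)
  moreover have "(\<Sum>t\<in>TS. receipt (second_center t))
      = (\<Sum>t\<in>TT. if t \<in> TS then receipt (second_center t) else 0)"
    using finTT TS_sub by (intro sum.mono_neutral_cong_left) auto
  moreover have "(\<Sum>c\<in>tight_codewords. loss c - \<theta>) = (\<Sum>t\<in>TT. loss (cw t) - \<theta>)"
    unfolding cw_image[symmetric] by (simp add: sum.reindex cw_inj)
  moreover have "0 \<le> (\<Sum>t\<in>TT. (loss (cw t) - \<theta>) + receipt (ctr t)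
      + (if t \<in> TS then receipt (second_center t) else 0))"
  proof (intro sum_nonneg)
    fix t assume "t \<in> TT"
    then obtain a b u where abu: "t = (a, b, u)" and t: "tight a b u" by (auto simp: TT_def)
    have "(real n - 1) * star_gain = (real n - 1) / 2 - 1"
      using n_ge by (simp add: right_diff_distrib)
    then have ru: "(real n - 1) / 2 - (real n - 1) * \<theta> \<le> receipt u"
      using receipt_tight[OF t] by linarith
    have rs: "(real n - 3) / 60 \<le> receipt (second_center (a, b, u))" if s: "\<exists>j. second a b u j"
      using second_center_obtain[OF s] receipt_second[OF t] by metis
    have "0 \<le> (loss (flip a (flip b u)) - \<theta>) + receipt u
      + (if t \<in> TS then receipt (second_center (a, b, u)) else 0)"
    \<comment> \<open>Each triple balances on its own: by \<open>\<theta>_tight\<close> if the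
      compensating codeword loses enough, otherwise by \<open>\<theta>_tight_star\<close> with the
      receipt of the second centre.\<close>
    proof (cases "7 / 6 - 1 / (real n - 5) \<le> loss (flip a (flip b u))")
      case True
      have "0 \<le> (real n - 3) / 60" using n_ge by simp
      then have "0 \<le> (if t \<in> TS then receipt (second_center (a, b, u)) else 0)"
        using rs abu order_trans by (fastforce simp: TS_def)
      moreover have "0 \<le> (loss (flip a (flip b u)) - \<theta>) + receipt u"
        using True ru \<theta>_tight left_diff_distrib[of "real n" 1 \<theta>] diff_divide_distrib[of "real n" 1 2]
        by linarith
      ultimately show ?thesis by linarith
    next
      case False
      then have l: "1 - 1 / (real n - 2) \<le> loss (flip a (flip b u))" and s: "\<exists>j. second a b u j"
        using tight_loss[OF t] by auto
      have "t \<in> TS" using t s abu by (simp add: TS_def)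
      moreover have "0 \<le> (loss (flip a (flip b u)) - \<theta>) + receipt u + receipt (second_center (a, b, u))"
        using l ru rs[OF s] \<theta>_tight_star left_diff_distrib[of "real n" 1 \<theta>]
          diff_divide_distrib[of "real n" 1 2] by linarith
      ultimately show ?thesis by simp
    qed
    then show "0 \<le> (loss (cw t) - \<theta>) + receipt (ctr t)
      + (if t \<in> TS then receipt (second_center t) else 0)"
      by (simp add: cw_def ctr_def abu split: if_splits)
  qed
  ultimately have "0 \<le> (\<Sum>c\<in>tight_codewords. loss c - \<theta>) + (\<Sum>v\<in>?V. receipt v)"
    by (simp add: sum.distrib)
  also have "\<dots> \<le> (\<Sum>c\<in>tight_codewords. loss c - \<theta>) + (\<Sum>c\<in>C - tight_codewords. loss c - \<theta>)"
    unfolding sum_pay_eq_sum_receipt[symmetric]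
    using loss_ge_pay by (intro add_left_mono sum_mono) auto
  also have "\<dots> = (\<Sum>c\<in>C. loss c - \<theta>)"
    using sum.subset_diff[OF tc_C finite_C, of "\<lambda>c. loss c - \<theta>"] by linarith
  finally show ?thesis by (simp add: sum_subtractf)
qed

lemma card_W_le: "real (card W) \<le> real (card C) * ((real n + 3) / 2 - \<theta>)"
  using sum_loss_ge sum_loss by (simp add: algebra_simps)

end

section \<open>Binary words\<close>

definition flip_bit :: "nat \<Rightarrow> bool list \<Rightarrow> bool list" where
  "flip_bit i w = w[i := \<not> w ! i]"

lemma length_flip_bit [simp]: "length (flip_bit i w) = length w"
  by (simp add: flip_bit_def)

lemma nth_flip_bit: "k < length w \<Longrightarrow> flip_bit i w ! k = (if k = i then \<not> w ! k else w ! k)"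
  by (simp add: flip_bit_def nth_list_update)

lemma flip_bit_flip_bit: "flip_bit i (flip_bit i w) = w"
  by (rule nth_equalityI) (auto simp: nth_flip_bit)

lemma flip_bit_commute: "flip_bit i (flip_bit j w) = flip_bit j (flip_bit i w)"
  by (rule nth_equalityI) (auto simp: nth_flip_bit)

lemma flip_bit_inj: "i < length w \<Longrightarrow> flip_bit i w = flip_bit j w \<Longrightarrow> i = j"
  by (metis nth_flip_bit)

lemma hamming_dist_flip_bit: "i < length w \<Longrightarrow> hamming_dist w (flip_bit i w) = 1"
proof -
  assume "i < length w"
  then have "{k. k < length w \<and> w ! k \<noteq> flip_bit i w ! k} = {i}"
    by (auto simp: nth_flip_bit split: if_splits)
  then show ?thesis by (simp add: hamming_dist_def)
qed

lemma hamming_dist_1_flip_bit: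
  assumes "length v = length u" "hamming_dist u v = 1"
  obtains i where "i < length u" "v = flip_bit i u"
proof -
  obtain i where i: "{k. k < length u \<and> u ! k \<noteq> v ! k} = {i}"
    using assms(2) by (auto simp: hamming_dist_def card_1_singleton_iff)
  have "v = flip_bit i u"
  proof (rule nth_equalityI)
    fix k assume "k < length v"
    moreover have "k < length u \<and> u ! k \<noteq> v ! k \<longleftrightarrow> k = i" using i by blast
    ultimately show "v ! k = flip_bit i u ! k" using assms(1) by (auto simp: nth_flip_bit)
  qed (simp add: assms(1))
  then show ?thesis using that i by blast
qed

lemma I_set_flip_bit:
  assumes u: "length u = n" "u \<notin> C" and C: "C \<subseteq> hamming_space n"
  shows "I_set n C u = (\<lambda>k. flip_bit k u) ` {k. k < n \<and> flip_bit k u \<in> C}"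
proof
  show "I_set n C u \<subseteq> (\<lambda>k. flip_bit k u) ` {k. k < n \<and> flip_bit k u \<in> C}"
  proof
    fix v assume v: "v \<in> I_set n C u"
    then have "v \<in> C" "hamming_dist u v = 1" "length v = length u"
      using u by (auto simp: I_set_def closed_nbhd_def hamming_space_def)
    then show "v \<in> (\<lambda>k. flip_bit k u) ` {k. k < n \<and> flip_bit k u \<in> C}"
      using u hamming_dist_1_flip_bit by blast
  qed
  show "(\<lambda>k. flip_bit k u) ` {k. k < n \<and> flip_bit k u \<in> C} \<subseteq> I_set n C u"
    using u hamming_dist_flip_bit by (auto simp: I_set_def closed_nbhd_def hamming_space_def)
qed

text \<open>Direction sets {i} and {j} at \<open>flip_bit i c\<close> and
  \<open>flip_bit j c\<close> both encode the I-set {c}; the set {i, j} at both encodes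
  \<open>c\<close> and the word differing from it in \<open>i\<close> and \<open>j\<close>. Both
  uniqueness assumptions are thus cases of separation.\<close>

lemma ld_cube_hamming:
  assumes ld: "locating_dominating n C"
  shows "ld_cube n (hamming_space n) flip_bit C"
proof -
  have C: "C \<subseteq> hamming_space n"
    and dom: "\<And>u. u \<in> hamming_space n \<Longrightarrow> I_set n C u \<noteq> {}"
    and sep: "\<And>u v. u \<in> hamming_space n - C \<Longrightarrow> v \<in> hamming_space n - C \<Longrightarrow>
      I_set n C u = I_set n C v \<Longrightarrow> u = v"
    using ld by (auto simp: locating_dominating_def is_code_def)
  have sep': "i = j"
    if c: "c \<in> C" and i: "i < n" "flip_bit i c \<notin> C" and j: "flip_bit j c \<notin> C"
      and eq: "(\<lambda>k. flip_bit k (flip_bit i c)) ` {k. k < n \<and> flip_bit k (flip_bit i c) \<in> C}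
        = (\<lambda>k. flip_bit k (flip_bit j c)) ` {k. k < n \<and> flip_bit k (flip_bit j c) \<in> C}" for c i j
  proof -
    have len: "length c = n" using c C by (auto simp: hamming_space_def)
    have "I_set n C (flip_bit i c) = I_set n C (flip_bit j c)"
      using I_set_flip_bit[OF _ i(2) C] I_set_flip_bit[OF _ j C] eq len by simp
    then have "flip_bit i c = flip_bit j c"
      using sep len i j by (simp add: hamming_space_def)
    then show ?thesis using flip_bit_inj i len by blast
  qed
  have "finite (hamming_space n)"
    using finite_lists_length_eq[of "UNIV :: bool set" n] by (simp add: hamming_space_def)
  moreover have "\<exists>i<n. flip_bit i v \<in> C" if v: "v \<in> hamming_space n" "v \<notin> C" for v
    using dom[OF v(1)] I_set_flip_bit[of v n C] v C by (auto simp: hamming_space_def)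
  ultimately show ?thesis
  proof (unfold_locales, goal_cases)
    case (2 v i)
    then show ?case by (simp add: hamming_space_def)
  next
    case (7 c i j)
    then show ?case using sep'[of c i j] by (auto simp: flip_bit_flip_bit)
  next
    case (8 c i j)
    show ?case
    proof
      assume "{k. k < n \<and> flip_bit k (flip_bit j c) \<in> C} = {i, j}"
      then have "i = j"
        using sep'[of c i j] 8 by (simp add: flip_bit_flip_bit flip_bit_commute[of j i] insert_commute)
      then show False using 8 by blast
    qed
  qed (use C in \<open>auto simp: flip_bit_flip_bit flip_bit_commute\<close>)
qed

text \<open>A separate \<open>D\<close> lets the denominators of the theorem be matched by an
  equation.\<close>

lemma gamma_LD_ge:
  assumes "11 \<le> n"
    and "\<theta> \<le> 2 / 3 - 1 / (real n - 4)"
    and "(real n - 1) * (\<theta> - (1 / 2 - 1 / (real n - 1))) \<le> 5 / 3"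
    and "real n * \<theta> + 1 / (real n - 5) \<le> real n / 2 + 2 / 3"
    and "real n * \<theta> + 1 / (real n - 2) \<le> real n / 2 + 1 / 2 + (real n - 3) / 60"
    and "\<theta> + 1 / (real n - 2) + 1 / 60 \<le> 2 / 3"
    and D: "D = real n + 3 - 2 * \<theta>"
  shows "2 ^ (n + 1) / D \<le> real (gamma_LD n)"
proof -
  obtain C where C: "locating_dominating n C" "card C = gamma_LD n"
    using gamma_LD_attained by blast
  interpret ld_cube n "hamming_space n" flip_bit C by (rule ld_cube_hamming[OF C(1)])
  interpret ld_cube_threshold n "hamming_space n" flip_bit C \<theta>
    using assms by unfold_locales auto
  have "card (hamming_space n) = 2 ^ n"
    using card_lists_length_eq[of "UNIV :: bool set" n] by (simp add: hamming_space_def)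
  then have "2 ^ n \<le> real (gamma_LD n) * (D / 2)"
    using card_W_le C(2) D by (simp add: diff_divide_distrib add_divide_distrib)
  moreover have "0 < D" using D \<theta>_le_two_thirds by simp
  ultimately show ?thesis by (simp add: divide_le_eq)
qed

theorem theorem7:
  fixes n :: nat
  shows "(11 \<le> n \<and> n \<le> 12 \<longrightarrow>
            real (gamma_LD n) \<ge>
              2 ^ (n + 1) / (real n + 1 + 2 * (real n - 1) / (3 * (real n - 4)))) \<and>
         (n \<ge> 13 \<longrightarrow>
            real (gamma_LD n) \<ge>
              2 ^ (n + 1) / (real n + 2 + 2 / ((real n)\<^sup>2 - 5 * real n) - 4 / (3 * real n)))"
proof (intro conjI impI)
  assume n: "11 \<le> n \<and> n \<le> 12"
  then consider "n = 11" | "n = 12" by linarith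
  then show "real (gamma_LD n) \<ge>
      2 ^ (n + 1) / (real n + 1 + 2 * (real n - 1) / (3 * (real n - 4)))"
    \<comment> \<open>For these two values of \<open>n\<close> the binding condition is
      \<open>\<theta>_le\<close>, so \<theta> is its extreme value.\<close>
    using n by cases (intro gamma_LD_ge[where \<theta> = "2 / 3 - 1 / (real n - 4)"]; simp)+
next
  assume n: "13 \<le> n"
  \<comment> \<open>From 13 on \<open>\<theta>_tight\<close> is binding; this value makes it an
    equality.\<close>
  let ?\<theta> = "1 / 2 + 2 / (3 * real n) - 1 / (real n * (real n - 5))"
  have pos: "0 \<le> 1 / (real n * (real n - 5))" using n by simp
  have n1: "2 / (3 * real n) \<le> 2 / 39" using n by (intro divide_left_mono) auto
  have n2: "1 / (real n - 2) \<le> 1 / 11" using n by (intro divide_left_mono) auto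
  have n4: "1 / (real n - 4) \<le> 1 / 9" using n by (intro divide_left_mono) auto
  have n25: "1 / (real n - 2) \<le> 1 / (real n - 5)" using n by (intro divide_left_mono) auto
  have n\<theta>: "real n * ?\<theta> = real n / 2 + 2 / 3 - 1 / (real n - 5)"
  proof -
    have "real n * (2 / (3 * real n)) = 2 / 3" using n by simp
    moreover have "real n * (1 / (real n * (real n - 5))) = 1 / (real n - 5)"
      using n by simp
    moreover have "real n * ?\<theta> = real n * (1 / 2) + real n * (2 / (3 * real n))
        - real n * (1 / (real n * (real n - 5)))"
      by (simp only: right_diff_distrib distrib_left)
    ultimately show ?thesis by linarith
  qed
  show "real (gamma_LD n) \<ge>
      2 ^ (n + 1) / (real n + 2 + 2 / ((real n)\<^sup>2 - 5 * real n) - 4 / (3 * real n))"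
  proof (rule gamma_LD_ge[where \<theta> = ?\<theta>])
    show "?\<theta> \<le> 2 / 3 - 1 / (real n - 4)" using pos n1 n4 by linarith
    have "(real n - 1) * (?\<theta> - (1 / 2 - 1 / (real n - 1)))
        = real n * ?\<theta> - ?\<theta> - (real n - 1) / 2 + 1"
      using n by (simp add: algebra_simps) (simp add: field_simps)
    moreover have "1 / (real n * (real n - 5)) \<le> 1 / (real n - 5)"
      using n by (intro divide_left_mono) auto
    moreover have "0 \<le> 2 / (3 * real n)" by simp
    \<comment> \<open>On the right the terms 1/(n - 5) cancel, leaving exactly 5/3.\<close>
    ultimately have "(real n - 1) * (?\<theta> - (1 / 2 - 1 / (real n - 1)))
        \<le> (real n / 2 + 2 / 3 - 1 / (real n - 5)) - (1 / 2 - 1 / (real n - 5)) - (real n - 1) / 2 + 1"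
      unfolding n\<theta> by linarith
    then show "(real n - 1) * (?\<theta> - (1 / 2 - 1 / (real n - 1))) \<le> 5 / 3"
      by (simp add: diff_divide_distrib)
    show "real n * ?\<theta> + 1 / (real n - 5) \<le> real n / 2 + 2 / 3" using n\<theta> by linarith
    show "real n * ?\<theta> + 1 / (real n - 2) \<le> real n / 2 + 1 / 2 + (real n - 3) / 60"
      unfolding n\<theta> using n25 n by (simp add: diff_divide_distrib)
    show "?\<theta> + 1 / (real n - 2) + 1 / 60 \<le> 2 / 3" using pos n1 n2 by linarith
    have "(real n)\<^sup>2 - 5 * real n = real n * (real n - 5)"
      by (simp add: power2_eq_square algebra_simps)
    then show "real n + 2 + 2 / ((real n)\<^sup>2 - 5 * real n) - 4 / (3 * real n) = real n + 3 - 2 * ?\<theta>"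
      by simp
  qed (use n in simp)
qed

end
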